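(* Let $X=\ell_p(\mathbb N)$ with $p\in[1,+\infty)$, or $X=c_0(\mathbb N)$. Let $\alpha\in(0,1]$, let $(w(a))_{a>0}$ be the family of weights defined by $w_1(a)\cdots w_n(a)=\exp(an^\alpha)$ for all $n\ge1$ and all $a>0$, let $d\geq 1$ and let $\Lambda\subset(0,+\infty)^d$ be compact. Assume that $\dim_{\rm HB}(\Lambda)<1/\alpha$. Then $(B_{w(\lambda(1))}\times\cdots\times B_{w(\lambda(d))})_{\lambda\in\Lambda}$ admits a common hypercyclic vector in $X^d$.
   Context: $(e_n)_{n\ge0}$ is the canonical basis of $X$. For a sequence $w=(w_n)_{n\ge1}$ of positive numbers, $B_w$ is the weighted backward shift on $X$: $B_we_0=0$ and $B_we_n=w_ne_{n-1}$ for $n\ge1$. Products of operators act coordinatewise on $X^d$; $\lambda=(\lambda(1),\dots,\lambda(d))$. A common hypercyclic vector for a family of operators is a vector $x$ such that $\{T^nx:n\ge0\}$ is dense for every operator $T$ in the family. $\mathbb R^d$ is endowed with the sup-norm. For $r\ge1$ put $I_r=\{1,\dots,r\}$. A compact set $\Lambda\subset\mathbb R^d$ has homogeneous box dimension at most $\gamma\in(0,d]$ if there exist an integer $r\ge2$, a constant $C(\Lambda)>0$ and, for all $m\ge1$, a family $(\Lambda_{\mathbf k})_{\mathbf k\in I_r^m}$ of compact subsets of $\Lambda$ such that for all $m\ge1$: (1) $\operatorname{diam}(\Lambda_{\mathbf k})\le C(\Lambda)\left(\frac{1}{r^{1/\gamma}}\right)^m$ for all $\mathbf k\in I_r^m$;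 (2) $\Lambda\subset\bigcup_{\mathbf k\in I_r^m}\Lambda_{\mathbf k}$; (3) $\Lambda_{k_1,\dots,k_m}\subset\Lambda_{k_1,\dots,k_{m-1}}$ for all $\mathbf k\in I_r^m$ (for $m=1$ the right-hand side is $\Lambda$). The homogeneous box dimension $\dim_{\rm HB}(\Lambda)$ is the infimum of the $\gamma\in(0,d]$ such that $\Lambda$ has homogeneous box dimension at most $\gamma$. *)

theory Defs
  imports "HOL-Analysis.Analysis"
begin

section \<open>The sequence spaces\<close>

text \<open>
  The scalar field is a type \<open>'a\<close> of class \<open>{real_normed_field, euclidean_space}\<close>, which covers
  \<^typ>\<open>real\<close> and \<^typ>\<open>complex\<close> simultaneously. A sequence space is a set of functions
  \<open>nat \<Rightarrow> 'a\<close>, the basis vector \<open>e\<^sub>n\<close> being the indicator of \<open>n\<close>.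
\<close>

definition lp_space :: "real \<Rightarrow> (nat \<Rightarrow> 'a::real_normed_vector) set" where
  "lp_space p = {x. summable (\<lambda>n. norm (x n) powr p)}"

definition lp_norm :: "real \<Rightarrow> (nat \<Rightarrow> 'a::real_normed_vector) \<Rightarrow> real" where
  "lp_norm p x = (\<Sum>n. norm (x n) powr p) powr (1 / p)"

definition c0_space :: "(nat \<Rightarrow> 'a::real_normed_vector) set" where
  "c0_space = {x. x \<longlonglongrightarrow> 0}"

definition c0_norm :: "(nat \<Rightarrow> 'a::real_normed_vector) \<Rightarrow> real" where
  "c0_norm x = (SUP n. norm (x n))"

text \<open>
  The distance \<open>N (x - y)\<close> on the space \<open>M\<close>. The value outside \<open>M\<close> is irrelevant; it is set to 0
  because the locale \<^locale>\<open>Metric_space\<close> wants nonnegativity and symmetry on the whole type.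
\<close>

definition norm_dist ::
  "(nat \<Rightarrow> 'a::real_normed_vector) set \<Rightarrow> ((nat \<Rightarrow> 'a) \<Rightarrow> real) \<Rightarrow> (nat \<Rightarrow> 'a) \<Rightarrow> (nat \<Rightarrow> 'a) \<Rightarrow> real" where
  "norm_dist M N x y = (if x \<in> M \<and> y \<in> M then N (\<lambda>n. x n - y n) else 0)"

definition lp_topology :: "real \<Rightarrow> (nat \<Rightarrow> 'a::real_normed_vector) topology" where
  "lp_topology p = Metric_space.mtopology (lp_space p) (norm_dist (lp_space p) (lp_norm p))"

definition c0_topology :: "(nat \<Rightarrow> 'a::real_normed_vector) topology" where
  "c0_topology = Metric_space.mtopology c0_space (norm_dist c0_space c0_norm)"

lemma powr_convex_0:
  fixes s t u v p :: real
  assumes "p \<ge> 1" "s \<ge> 0" "t \<ge> 0" "s + t = 1" "u \<ge> 0" "v \<ge> 0"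
  shows "(s * u + t * v) powr p \<le> s * u powr p + t * v powr p"
proof -
  have aux: "(r * z) powr p \<le> r * z powr p" if "0 \<le> r" "r \<le> 1" "0 \<le> z" for r z :: real
  proof (cases "r = 0")
    case False
    have "r powr p \<le> r powr 1"
      using that False assms(1) by (intro powr_mono') auto
    then show ?thesis
      using that False by (simp add: powr_mult mult_right_mono)
  qed simp
  consider "u = 0" | "v = 0" | "u > 0" "v > 0"
    using assms by linarith
  then show ?thesis
  proof cases
    case 1
    then show ?thesis using aux[of t v] assms by auto
  next
    case 2
    then show ?thesis using aux[of s u] assms by auto
  next
    case 3
    have s: "s = 1 - t" "t \<le> 1"
      using assms by auto
    from 3 show ?thesis
      using convex_onD[OF powr_convex[OF assms(1)], of t u v] assms(3) s by simp
  qed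
qed

lemma lp_norm_nonneg: "lp_norm p x \<ge> 0"
  by (simp add: lp_norm_def)

lemma lp_norm_powr:
  assumes "p \<ge> 1" "x \<in> lp_space p"
  shows "lp_norm p x powr p = (\<Sum>n. norm (x n) powr p)"
  using assms by (simp add: lp_norm_def lp_space_def powr_powr suminf_nonneg)

lemma lp_norm_eq_0:
  assumes "p \<ge> 1" "x \<in> lp_space p"
  shows "lp_norm p x = 0 \<longleftrightarrow> x = (\<lambda>_. 0)"
  using assms suminf_eq_zero_iff[of "\<lambda>n. norm (x n) powr p"]
  by (auto simp: lp_norm_def lp_space_def fun_eq_iff)

lemma lp_triangle:
  fixes x y :: "nat \<Rightarrow> 'a::real_normed_vector"
  assumes p: "p \<ge> 1" and x: "x \<in> lp_space p" and y: "y \<in> lp_space p"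
  shows "(\<lambda>n. x n + y n) \<in> lp_space p"
    and "lp_norm p (\<lambda>n. x n + y n) \<le> lp_norm p x + lp_norm p y"
proof -
  define A B where "A = lp_norm p x" and "B = lp_norm p y"
  have AB0: "A \<ge> 0" "B \<ge> 0"
    by (simp_all add: A_def B_def lp_norm_nonneg)
  have "(\<lambda>n. x n + y n) \<in> lp_space p \<and> lp_norm p (\<lambda>n. x n + y n) \<le> A + B"
  proof (cases "A = 0 \<or> B = 0")
    case True
    then have "x = (\<lambda>_. 0) \<or> y = (\<lambda>_. 0)"
      using lp_norm_eq_0[OF p x] lp_norm_eq_0[OF p y] by (auto simp: A_def B_def)
    then show ?thesis
      using x y AB0 by (auto simp: A_def B_def)
  next
    case False
    with AB0 have A: "A > 0" and B: "B > 0" by auto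
    define h where "h n = (A + B) powr p *
      (A / (A + B) * (norm (x n) powr p / A powr p) + B / (A + B) * (norm (y n) powr p / B powr p))" for n
    have le: "norm (x n + y n) powr p \<le> h n" for n
    proof -
      have "norm (x n + y n) powr p \<le> (norm (x n) + norm (y n)) powr p"
        using p by (intro powr_mono2 norm_triangle_ineq) auto
      also have "norm (x n) + norm (y n) =
          (A + B) * (A / (A + B) * (norm (x n) / A) + B / (A + B) * (norm (y n) / B))"
        using A B by (simp add: distrib_left)
      also have "\<dots> powr p =
          (A + B) powr p * (A / (A + B) * (norm (x n) / A) + B / (A + B) * (norm (y n) / B)) powr p"
        using A B by (intro powr_mult; auto)
      also have "\<dots> \<le> (A + B) powr p *
          (A / (A + B) * (norm (x n) / A) powr p + B / (A + B) * (norm (y n) / B) powr p)"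
        using A B p by (intro mult_left_mono powr_convex_0) (auto simp: add_divide_distrib[symmetric])
      also have "\<dots> = h n"
        using A B by (simp add: h_def powr_divide)
      finally show ?thesis .
    qed
    have sx: "(\<lambda>n. norm (x n) powr p) sums (A powr p)"
      and sy: "(\<lambda>n. norm (y n) powr p) sums (B powr p)"
      using x y lp_norm_powr[OF p x] lp_norm_powr[OF p y]
      by (auto simp: A_def B_def lp_space_def summable_sums)
    have "h sums ((A + B) powr p *
      (A / (A + B) * (A powr p / A powr p) + B / (A + B) * (B powr p / B powr p)))"
      unfolding h_def by (intro sums_mult sums_add sums_divide sx sy)
    moreover have "A / (A + B) + B / (A + B) = 1"
      using A B by (simp add: add_divide_distrib[symmetric])
    ultimately have h: "h sums ((A + B) powr p)"
      using A B by simp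
    have sm: "summable (\<lambda>n. norm (x n + y n) powr p)"
      by (rule summable_comparison_test[of _ h]) (use le h in \<open>auto simp: sums_iff\<close>)
    have "(\<Sum>n. norm (x n + y n) powr p) \<le> (A + B) powr p"
      using suminf_le[OF le sm] h by (simp add: sums_iff)
    then have "lp_norm p (\<lambda>n. x n + y n) \<le> ((A + B) powr p) powr (1 / p)"
      unfolding lp_norm_def using p sm by (intro powr_mono2) (auto intro: suminf_nonneg)
    then show ?thesis
      using sm p A B by (simp add: lp_space_def powr_powr)
  qed
  then show "(\<lambda>n. x n + y n) \<in> lp_space p"
    and "lp_norm p (\<lambda>n. x n + y n) \<le> lp_norm p x + lp_norm p y"
    by (auto simp: A_def B_def)
qed

lemma lp_diff:
  assumes "p \<ge> 1" "x \<in> lp_space p" "y \<in> lp_space p"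
  shows "(\<lambda>n. x n - y n) \<in> lp_space p"
  using lp_triangle(1)[OF assms(1,2), of "\<lambda>n. - y n"] assms(3) by (simp add: lp_space_def)

lemma Metric_space_lp:
  assumes "p \<ge> 1"
  shows "Metric_space (lp_space p) (norm_dist (lp_space p) (lp_norm p :: (nat \<Rightarrow> 'a::real_normed_vector) \<Rightarrow> real))"
proof
  fix x y z :: "nat \<Rightarrow> 'a"
  show "0 \<le> norm_dist (lp_space p) (lp_norm p) x y"
    by (simp add: norm_dist_def lp_norm_nonneg)
  show "norm_dist (lp_space p) (lp_norm p) x y = norm_dist (lp_space p) (lp_norm p) y x"
    by (auto simp: norm_dist_def lp_norm_def norm_minus_commute)
  assume xy: "x \<in> lp_space p" "y \<in> lp_space p"
  then show "norm_dist (lp_space p) (lp_norm p) x y = 0 \<longleftrightarrow> x = y"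
    using lp_norm_eq_0[OF assms lp_diff[OF assms xy]] by (simp add: norm_dist_def fun_eq_iff)
  assume z: "z \<in> lp_space p"
  show "norm_dist (lp_space p) (lp_norm p) x z
    \<le> norm_dist (lp_space p) (lp_norm p) x y + norm_dist (lp_space p) (lp_norm p) y z"
    using lp_triangle(2)[OF assms lp_diff[OF assms xy] lp_diff[OF assms xy(2) z]] xy z
    by (simp add: norm_dist_def)
qed

lemma c0_norm_bound:
  assumes "x \<in> c0_space"
  shows "norm (x n) \<le> c0_norm x"
proof -
  have "Bseq x"
    using assms by (auto simp: c0_space_def intro: convergent_imp_Bseq convergentI)
  then have "bdd_above (range (\<lambda>n. norm (x n)))"
    by (auto elim!: BseqE intro: bdd_aboveI2)
  then show ?thesis
    unfolding c0_norm_def by (rule cSUP_upper2) auto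
qed

lemma c0_diff: "x \<in> c0_space \<Longrightarrow> y \<in> c0_space \<Longrightarrow> (\<lambda>n. x n - y n) \<in> c0_space"
  unfolding c0_space_def using tendsto_diff by fastforce

lemma Metric_space_c0:
  "Metric_space c0_space (norm_dist c0_space (c0_norm :: (nat \<Rightarrow> 'a::real_normed_vector) \<Rightarrow> real))"
proof
  fix x y z :: "nat \<Rightarrow> 'a"
  have nonneg: "c0_norm u \<ge> 0" if "u \<in> c0_space" for u :: "nat \<Rightarrow> 'a"
    using c0_norm_bound[OF that, of 0] norm_ge_zero[of "u 0"] by linarith
  then show "0 \<le> norm_dist c0_space c0_norm x y"
    by (simp add: norm_dist_def c0_diff)
  show "norm_dist c0_space c0_norm x y = norm_dist c0_space c0_norm y x"
    by (auto simp: norm_dist_def c0_norm_def norm_minus_commute)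
  assume xy: "x \<in> c0_space" "y \<in> c0_space"
  show "norm_dist c0_space c0_norm x y = 0 \<longleftrightarrow> x = y"
  proof
    assume "norm_dist c0_space c0_norm x y = 0"
    then show "x = y"
      using c0_norm_bound[OF c0_diff[OF xy]] xy by (auto simp: norm_dist_def fun_eq_iff)
  qed (simp add: norm_dist_def c0_norm_def)
  assume z: "z \<in> c0_space"
  have "norm (x n - z n) \<le> c0_norm (\<lambda>n. x n - y n) + c0_norm (\<lambda>n. y n - z n)" for n
    using c0_norm_bound[OF c0_diff[OF xy], of n] c0_norm_bound[OF c0_diff[OF xy(2) z], of n]
      norm_triangle_ineq[of "x n - y n" "y n - z n"] by simp
  then have "c0_norm (\<lambda>n. x n - z n) \<le> c0_norm (\<lambda>n. x n - y n) + c0_norm (\<lambda>n. y n - z n)"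
    unfolding c0_norm_def[of "\<lambda>n. x n - z n"] by (intro cSUP_least) auto
  then show "norm_dist c0_space c0_norm x z
    \<le> norm_dist c0_space c0_norm x y + norm_dist c0_space c0_norm y z"
    using xy z by (simp add: norm_dist_def)
qed

lemma topspace_lp: "p \<ge> 1 \<Longrightarrow> topspace (lp_topology p) = lp_space p"
  by (simp add: lp_topology_def Metric_space.topspace_mtopology[OF Metric_space_lp])

lemma topspace_c0: "topspace c0_topology = c0_space"
  by (simp add: c0_topology_def Metric_space.topspace_mtopology[OF Metric_space_c0])


section \<open>Weighted backward shifts and hypercyclicity\<close>

text \<open>
  Coordinatewise form of the continuous linear operator with \<open>B\<^sub>w e\<^sub>0 = 0\<close> and
  \<open>B\<^sub>w e\<^sub>n = w\<^sub>n e\<^bsub>n-1\<^esub>\<close>; the value \<open>w 0\<close> is never used.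
\<close>

definition weighted_shift ::
  "(nat \<Rightarrow> real) \<Rightarrow> (nat \<Rightarrow> 'a::real_normed_vector) \<Rightarrow> (nat \<Rightarrow> 'a)" where
  "weighted_shift w x = (\<lambda>n. w (Suc n) *\<^sub>R x (Suc n))"

abbreviation basis_vec :: "nat \<Rightarrow> nat \<Rightarrow> 'a::real_normed_field" where
  "basis_vec n \<equiv> (\<lambda>k. if k = n then 1 else 0)"

lemma weighted_shift_basis:
  "weighted_shift w (basis_vec 0) = (\<lambda>_. 0)"
  "n \<ge> 1 \<Longrightarrow> weighted_shift w (basis_vec n) = (\<lambda>k. w n *\<^sub>R basis_vec (n - 1) k)"
  by (auto simp: weighted_shift_def fun_eq_iff)

definition product_op :: "('d \<Rightarrow> 'b \<Rightarrow> 'b) \<Rightarrow> ('d \<Rightarrow> 'b) \<Rightarrow> ('d \<Rightarrow> 'b)" where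
  "product_op T x = (\<lambda>i. T i (x i))"

text \<open>Operators act on \<^term>\<open>topspace X\<close>, which need not be the whole type.\<close>

definition common_hypercyclic_vector ::
  "'b topology \<Rightarrow> 'l set \<Rightarrow> ('l \<Rightarrow> 'b \<Rightarrow> 'b) \<Rightarrow> 'b \<Rightarrow> bool" where
  "common_hypercyclic_vector X \<Lambda> T x \<longleftrightarrow>
     x \<in> topspace X \<and>
     (\<forall>l\<in>\<Lambda>. X closure_of (range (\<lambda>n. (T l ^^ n) x)) = topspace X)"


section \<open>Homogeneous box dimension\<close>

text \<open>
  The library's \<^const>\<open>diameter\<close> on \<open>real^'d\<close> is Euclidean; here \<open>real^'d\<close> carries the sup-norm
  \<^const>\<open>infnorm\<close>.
\<close>

definition sup_diameter :: "(real^'d) set \<Rightarrow> real" where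
  "sup_diameter S = (if S = {} then 0 else SUP (x, y)\<in>S \<times> S. infnorm (x - y))"

definition multi_indices :: "nat \<Rightarrow> nat \<Rightarrow> nat list set" where
  "multi_indices r m = {k. length k = m \<and> set k \<subseteq> {1..r}}"

text \<open>
  A single function \<open>L\<close> on lists represents the families for all \<open>m \<ge> 1\<close>; its value at the empty
  list is required to be \<open>\<Lambda>\<close>, in accordance with the convention for \<open>m = 1\<close> in the nesting condition.
\<close>

definition hom_box_dim_at_most :: "(real^'d) set \<Rightarrow> real \<Rightarrow> bool" where
  "hom_box_dim_at_most \<Lambda> \<gamma> \<longleftrightarrow>
     (\<exists>(r::nat) (C::real) (L :: nat list \<Rightarrow> (real^'d) set).
        r \<ge> 2 \<and> C > 0 \<and> L [] = \<Lambda> \<and>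
        (\<forall>m\<ge>1.
           (\<forall>k\<in>multi_indices r m. compact (L k) \<and> L k \<subseteq> \<Lambda>) \<and>
           (\<forall>k\<in>multi_indices r m. sup_diameter (L k) \<le> C * (1 / real r powr (1 / \<gamma>)) ^ m) \<and>
           \<Lambda> \<subseteq> (\<Union>k\<in>multi_indices r m. L k) \<and>
           (\<forall>k\<in>multi_indices r m. L k \<subseteq> L (butlast k))))"

text \<open>
  The infimum is taken in the extended reals, so that it would be \<open>\<infinity>\<close> for an empty set of
  \<open>\<gamma>\<close>. For compact \<open>\<Lambda>\<close> that set contains \<open>CARD('d)\<close> and the infimum is the real one.
\<close>

definition hom_box_dim :: "(real^'d) set \<Rightarrow> ereal" where
  "hom_box_dim \<Lambda> = (INF \<gamma>\<in>{\<gamma>. 0 < \<gamma> \<and> \<gamma> \<le> real CARD('d) \<and> hom_box_dim_at_most \<Lambda> \<gamma>}. ereal \<gamma>)"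

end

theory Submission
  imports Defs
begin

text \<open>
  Since \<open>w\<^sub>1(a) \<cdots> w\<^sub>n(a) = exp (a n\<^sup>\<alpha>)\<close>, the vector
  \<open>x(n) = \<Sum>\<^bsub>t \<le> n\<^esub> exp (-\<mu>\<^sub>t (n\<^sup>\<alpha> - (n - t)\<^sup>\<alpha>)) u\<^sub>t(n - t)\<close> is mapped at time \<open>k\<close> by the
  shift of parameter \<open>l\<close> close to \<open>u\<^sub>k\<close> in \<open>\<ell>\<^sub>1\<close> as soon as \<open>\<bar>l - \<mu>\<^sub>k\<bar> k\<^sup>\<alpha>\<close> is small (the main term) and
  \<open>\<bar>l - \<mu>\<^sub>t\<bar> t\<^sup>\<alpha> \<le> c (t - k)\<^sup>\<alpha>\<close> for the later times \<open>t\<close> (the tail). Times are grouped in stages; each stage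
  treats one vector of a countable dense set and samples \<open>\<Lambda>\<close> at the cells of a deep level \<open>m\<close> of the
  homogeneous covering. As \<open>\<Lambda>\<close> has homogeneous box dimension at most some \<open>\<gamma> < 1 / \<alpha>\<close>, one can fix a base
  \<open>\<beta>\<close> with \<open>r < \<beta> < r\<^bsup>1 / (\<alpha> \<gamma>)\<^esup>\<close>, and the \<open>r\<^sup>m\<close> cells fit into \<open>{T..2 T}\<close> like the
  pieces of a Cantor set of base \<open>\<beta>\<close>, where \<open>T\<close> is of order \<open>\<beta>\<^sup>m\<close>: cells with a common prefix of length
  \<open>s\<close> are at distance about \<open>T / \<beta>\<^sup>s\<close> in time and at most about \<open>r\<^bsup>-s / \<gamma>\<^esup> < \<beta>\<^bsup>-s \<alpha>\<^esup>\<close> in the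
  parameter.
\<close>

section \<open>Elementary estimates\<close>

text \<open>After division by \<open>x + y\<close> the claim follows from
  \<open>t \<le> t powr \<alpha>\<close> on \<open>[0, 1]\<close>.\<close>

lemma powr_add_subadditive:
  fixes x y \<alpha> :: real
  assumes "0 < \<alpha>" "\<alpha> \<le> 1" "0 \<le> x" "0 \<le> y"
  shows "(x + y) powr \<alpha> \<le> x powr \<alpha> + y powr \<alpha>"
proof (cases "x + y = 0")
  case False
  define s where "s = x + y"
  have s: "s > 0" using False assms by (simp add: s_def)
  have le: "t / s \<le> (t / s) powr \<alpha>" if "0 \<le> t" "t \<le> s" for t
  proof (cases "t = 0")
    case False
    then have "(t / s) powr 1 \<le> (t / s) powr \<alpha>"
      using that s assms by (intro powr_mono') auto
    then show ?thesis using that s False by simp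
  qed simp
  have "1 = x / s + y / s"
    using s by (simp add: s_def add_divide_distrib[symmetric])
  also have "\<dots> \<le> (x / s) powr \<alpha> + (y / s) powr \<alpha>"
    using assms by (intro add_mono le) (auto simp: s_def)
  also have "\<dots> = (x powr \<alpha> + y powr \<alpha>) / s powr \<alpha>"
    using assms s by (simp add: powr_divide add_divide_distrib)
  finally show ?thesis
    using s by (simp add: s_def field_simps)
qed (use assms in auto)

text \<open>Since \<open>ln n\<close> is negligible against \<open>n powr \<alpha>\<close>, the
  terms are eventually at most \<open>n powr (- 2)\<close>.\<close>

lemma summable_exp_neg_powr:
  fixes c \<alpha> :: real
  assumes "0 < c" "0 < \<alpha>"
  shows "summable (\<lambda>n::nat. exp (- c * real n powr \<alpha>))"
proof (rule summable_comparison_test_ev)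
  have "(\<lambda>n::nat. ln (real n) / real n powr \<alpha>) \<longlonglongrightarrow> 0"
    using lim_ln_over_power[OF assms(2)] .
  then have "\<forall>\<^sub>F n in sequentially. ln (real n) / real n powr \<alpha> < c / 2"
    using assms by (intro order_tendstoD(2)) auto
  then show "\<forall>\<^sub>F n in sequentially. norm (exp (- c * real n powr \<alpha>)) \<le> real n powr (- 2)"
    using eventually_gt_at_top[of 0]
  proof eventually_elim
    case (elim n)
    then have "2 * ln (real n) \<le> c * real n powr \<alpha>"
      by (simp add: field_simps)
    then show ?case
      using elim by (simp add: powr_def)
  qed
  show "summable (\<lambda>n. real n powr (- 2))"
    by (subst summable_real_powr_iff) simp
qed

lemma exp_minus_one_small:
  fixes \<epsilon> :: real
  assumes "0 < \<epsilon>"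
  obtains \<delta> where "0 < \<delta>" "\<And>z. \<bar>z\<bar> \<le> \<delta> \<Longrightarrow> \<bar>exp z - 1\<bar> \<le> \<epsilon>"
proof -
  have "((\<lambda>z::real. \<bar>exp z - 1\<bar>) \<longlongrightarrow> \<bar>exp 0 - 1\<bar>) (nhds 0)"
    by (intro tendsto_intros filterlim_ident)
  then have "\<forall>\<^sub>F z in nhds 0. \<bar>exp z - 1\<bar> < \<epsilon>"
    using assms by (intro order_tendstoD(2)) auto
  then obtain d where "d > 0" "\<And>z. dist z 0 < d \<Longrightarrow> \<bar>exp z - 1\<bar> < \<epsilon>"
    by (auto simp: eventually_nhds_metric)
  then show ?thesis
    by (intro that[of "d / 2"]) (auto intro: less_imp_le)
qed

lemma exp_neg_powr_small:
  fixes c \<alpha> W \<epsilon> :: real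
  assumes "0 < c" "0 < \<alpha>" "0 < \<epsilon>"
  obtains G :: nat where "\<And>n. n \<ge> G \<Longrightarrow> W * exp (- c * real n powr \<alpha>) \<le> \<epsilon>"
proof -
  have "(\<lambda>n. W * exp (- c * real n powr \<alpha>)) \<longlonglongrightarrow> W * 0"
    by (intro tendsto_intros summable_LIMSEQ_zero summable_exp_neg_powr assms)
  then have "\<forall>\<^sub>F n in sequentially. W * exp (- c * real n powr \<alpha>) < \<epsilon>"
    using assms by (intro order_tendstoD(2)) auto
  then show ?thesis
    using that by (auto simp: eventually_sequentially intro: less_imp_le)
qed

text \<open>Reindexing the triangular sum bounds the antidiagonals by the rows. A row is the
  contribution of one event at time \<open>s\<close>, with \<open>j\<close> counted from its start;
  both the vector to be built and its approximation errors are antidiagonal sums of such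
  rows.\<close>

lemma sum_convolution_le:
  fixes f :: "nat \<Rightarrow> nat \<Rightarrow> 'b::real_normed_vector"
  assumes f: "\<And>s J. (\<Sum>j<J. norm (f s j)) \<le> g s" and g: "summable g"
  shows "summable (\<lambda>n. norm (\<Sum>s\<le>n. f s (n - s)))"
    and "(\<Sum>n. norm (\<Sum>s\<le>n. f s (n - s))) \<le> (\<Sum>s. g s)"
proof -
  have g0: "0 \<le> g s" for s
    using f[where J = 0 and s = s] by simp
  have le: "(\<Sum>n<J. norm (\<Sum>s\<le>n. f s (n - s))) \<le> (\<Sum>s. g s)" for J
  proof -
    have "(\<Sum>n<J. norm (\<Sum>s\<le>n. f s (n - s))) \<le> (\<Sum>n<J. \<Sum>s\<le>n. norm (f s (n - s)))"
      by (intro sum_mono norm_sum)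
    also have "\<dots> = (\<Sum>(s, j)\<in>{(s, j). s + j < J}. norm (f s j))"
      by (rule sum.triangle_reindex[symmetric])
    also have "\<dots> \<le> (\<Sum>(s, j)\<in>{..<J} \<times> {..<J}. norm (f s j))"
      by (intro sum_mono2) auto
    also have "\<dots> = (\<Sum>s<J. \<Sum>j<J. norm (f s j))"
      by (simp add: sum.cartesian_product)
    also have "\<dots> \<le> (\<Sum>s<J. g s)"
      by (intro sum_mono f)
    also have "\<dots> \<le> (\<Sum>s. g s)"
      using g g0 by (intro sum_le_suminf) auto
    finally show ?thesis .
  qed
  show "summable (\<lambda>n. norm (\<Sum>s\<le>n. f s (n - s)))"
    by (rule summableI_nonneg_bounded[OF _ le]) simp
  then show "(\<Sum>n. norm (\<Sum>s\<le>n. f s (n - s))) \<le> (\<Sum>s. g s)"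
    by (rule suminf_le_const[OF _ le])
qed

text \<open>The left side equals \<open>(l - m) * (t + j) powr \<alpha> - l * (s + j) powr \<alpha>
  + m * j powr \<alpha>\<close>, whose terms are at most \<open>a / 2 * s powr \<alpha>\<close>,
  \<open>- a * s powr \<alpha>\<close> and \<open>b * N powr \<alpha>\<close>. Here \<open>t\<close>
  is a later time of the stage and \<open>s\<close> its delay.\<close>

lemma exponent_le_same_stage:
  fixes s t j N :: nat
  assumes "0 < \<alpha>" "0 < a" "a \<le> l" "0 \<le> m" "m \<le> b" "j \<le> N"
    and "\<bar>l - m\<bar> * real (t + j) powr \<alpha> \<le> a / 2 * real s powr \<alpha>"
  shows "l * (real (t + j) powr \<alpha> - real (s + j) powr \<alpha>) - m * (real (t + j) powr \<alpha> - real j powr \<alpha>)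
           \<le> b * real N powr \<alpha> - a / 2 * real s powr \<alpha>"
proof -
  have "(l - m) * real (t + j) powr \<alpha> \<le> \<bar>l - m\<bar> * real (t + j) powr \<alpha>"
    by (intro mult_right_mono) auto
  moreover have "a * real s powr \<alpha> \<le> l * real (s + j) powr \<alpha>"
    using assms by (intro mult_mono powr_mono2) auto
  moreover have "m * real j powr \<alpha> \<le> b * real N powr \<alpha>"
    using assms by (intro mult_mono powr_mono2) auto
  ultimately show ?thesis
    using assms(7) by (simp add: algebra_simps)
qed

text \<open>Across stages \<open>l\<close> and \<open>m\<close> need not be close. Subadditivity
  bounds the gain by \<open>b * k powr \<alpha>\<close>, which the distance between the stages makes
  at most half of the decay \<open>a * (k + s) powr \<alpha>\<close>; the other half
  remains.\<close>

lemma exponent_le_later_stage: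
  fixes k s j N :: nat
  assumes "0 < \<alpha>" "\<alpha> \<le> 1" "0 < a" "0 \<le> l" "l \<le> b" "a \<le> m" "m \<le> b" "j \<le> N"
    and "b * real k powr \<alpha> \<le> a / 2 * real (k + s) powr \<alpha>"
  shows "l * (real (k + s + j) powr \<alpha> - real (s + j) powr \<alpha>) - m * (real (k + s + j) powr \<alpha> - real j powr \<alpha>)
           \<le> b * real N powr \<alpha> - a / 2 * real s powr \<alpha>"
proof -
  have "real (k + s + j) powr \<alpha> - real (s + j) powr \<alpha> \<le> real k powr \<alpha>"
    using powr_add_subadditive[of \<alpha> "real k" "real (s + j)"] assms by (simp add: add.assoc)
  then have "l * (real (k + s + j) powr \<alpha> - real (s + j) powr \<alpha>) \<le> l * real k powr \<alpha>"
    using assms by (intro mult_left_mono) auto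
  moreover have "l * real k powr \<alpha> \<le> b * real k powr \<alpha>"
    using assms by (intro mult_right_mono) auto
  moreover have "a * real (k + s) powr \<alpha> \<le> m * real (k + s + j) powr \<alpha>"
    using assms by (intro mult_mono powr_mono2) auto
  moreover have "m * real j powr \<alpha> \<le> b * real N powr \<alpha>"
    using assms by (intro mult_mono powr_mono2) auto
  moreover have "a / 2 * real s powr \<alpha> \<le> a / 2 * real (k + s) powr \<alpha>"
    using assms by (intro mult_left_mono powr_mono2) auto
  ultimately show ?thesis
    using assms(9) by (simp add: right_diff_distrib)
qed

section \<open>Scheduling a set of small homogeneous box dimension\<close>

text \<open>
  A word over \<open>{1..r}\<close> is placed at the point of \<open>[0, 1]\<close> whose expansion in base \<open>\<beta> > r\<close> it
  codes; as \<open>\<beta>\<close> exceeds the number of digits, distinct words are separated as in a Cantor set.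
\<close>

fun offset :: "nat \<Rightarrow> real \<Rightarrow> nat list \<Rightarrow> real" where
  "offset r \<beta> [] = 0"
| "offset r \<beta> (a # w) = (real a - 1) / real r + offset r \<beta> w / \<beta>"

lemma offset_bounds:
  assumes "1 \<le> r" "real r \<le> \<beta>" "set w \<subseteq> {1..r}"
  shows "0 \<le> offset r \<beta> w" "offset r \<beta> w \<le> 1"
proof -
  have "0 \<le> offset r \<beta> w \<and> offset r \<beta> w \<le> 1"
    using assms(3)
  proof (induction w)
    case (Cons a w)
    then have IH: "0 \<le> offset r \<beta> w" "offset r \<beta> w \<le> 1" and a: "1 \<le> a" "a \<le> r"
      by auto
    have "offset r \<beta> w / \<beta> \<le> 1 / real r"
      using IH assms(1,2) by (intro frac_le) auto
    moreover have "(real a - 1) / real r \<le> (real r - 1) / real r"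
      using a by (intro divide_right_mono) auto
    moreover have "(real r - 1) / real r + 1 / real r = 1"
      using assms(1) by (simp add: add_divide_distrib[symmetric])
    moreover have "0 \<le> (real a - 1) / real r"
      using a by (intro divide_nonneg_nonneg) auto
    moreover have "0 \<le> offset r \<beta> w / \<beta>"
      using IH assms(1,2) by (intro divide_nonneg_nonneg) auto
    ultimately show ?case by simp
  qed simp
  then show "0 \<le> offset r \<beta> w" "offset r \<beta> w \<le> 1"
    by auto
qed

text \<open>The witness is the length of the longest common prefix. At the first differing digit the
  leading terms are at least \<open>1 / r\<close> apart, while the remainders change this by at most
  \<open>1 / \<beta>\<close>.\<close>

lemma offset_separated:
  assumes r: "1 \<le> r" "real r \<le> \<beta>"
    and "length u = length v" "u \<noteq> v" "set u \<subseteq> {1..r}" "set v \<subseteq> {1..r}"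
  shows "\<exists>s<length u. take s u = take s v \<and>
           (1 / real r - 1 / \<beta>) / \<beta> ^ s \<le> \<bar>offset r \<beta> u - offset r \<beta> v\<bar>"
  using assms(3-)
proof (induction u v rule: list_induct2)
  case (Cons a u b v)
  show ?case
  proof (cases "a = b")
    case True
    with Cons obtain s where "s < length u" "take s u = take s v"
      and s: "(1 / real r - 1 / \<beta>) / \<beta> ^ s \<le> \<bar>offset r \<beta> u - offset r \<beta> v\<bar>"
      by auto
    moreover have "(1 / real r - 1 / \<beta>) / \<beta> ^ Suc s \<le> \<bar>offset r \<beta> u - offset r \<beta> v\<bar> / \<beta>"
      using divide_right_mono[OF s, of \<beta>] r by (simp add: mult.commute)
    ultimately show ?thesis
      using True r by (intro exI[of _ "Suc s"]) (auto simp: diff_divide_distrib[symmetric])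
  next
    case False
    have "1 \<le> \<bar>real a - real b\<bar>"
      using False by linarith
    then have "1 / real r \<le> \<bar>(real a - real b) / real r\<bar>"
      using r by (simp add: divide_right_mono)
    moreover have "\<bar>offset r \<beta> u - offset r \<beta> v\<bar> \<le> 1"
      using offset_bounds[OF r, of u] offset_bounds[OF r, of v] Cons.prems by auto
    then have "\<bar>(offset r \<beta> u - offset r \<beta> v) / \<beta>\<bar> \<le> 1 / \<beta>"
      using r by (simp add: divide_right_mono)
    moreover have "offset r \<beta> (a # u) - offset r \<beta> (b # v) =
        (real a - real b) / real r + (offset r \<beta> u - offset r \<beta> v) / \<beta>"
      by (simp add: diff_divide_distrib)
    ultimately have "1 / real r - 1 / \<beta> \<le> \<bar>offset r \<beta> (a # u) - offset r \<beta> (b # v)\<bar>"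
      by linarith
    then show ?thesis
      by (intro exI[of _ 0]) simp
  qed
qed simp

text \<open>
  The set \<open>A\<close> collects the times of one stage and \<open>\<mu> t\<close> is the parameter sampled at time \<open>t\<close>. The two
  inequalities control, for a parameter \<open>l\<close> handled at time \<open>k\<close>, the main term and the tail.
\<close>

definition well_spread :: "real \<Rightarrow> real \<Rightarrow> (real^'d) set \<Rightarrow> (real^'d) set \<Rightarrow> bool" where
  "well_spread \<alpha> c \<Lambda> D \<longleftrightarrow>
     (\<forall>G B :: nat. \<forall>\<delta>>0. \<exists>T A \<mu>. B \<le> T \<and> A \<subseteq> {T..2 * T} \<and> \<mu> ` A \<subseteq> \<Lambda> \<and>
        (\<forall>k\<in>A. \<forall>t\<in>A. k < t \<longrightarrow> k + G \<le> t) \<and>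
        (\<forall>l\<in>D. \<exists>k\<in>A. \<forall>i.
           \<bar>l $ i - \<mu> k $ i\<bar> * real (2 * T + G) powr \<alpha> \<le> \<delta> \<and>
           (\<forall>t\<in>A. k < t \<longrightarrow> \<bar>l $ i - \<mu> t $ i\<bar> * real (2 * T + G) powr \<alpha> \<le> c * real (t - k) powr \<alpha>)))"

text \<open>Boundedness makes the real supremum in \<open>sup_diameter\<close> a genuine upper
  bound.\<close>

lemma component_diff_le_sup_diameter:
  assumes "bounded S" "x \<in> S" "y \<in> S"
  shows "\<bar>x $ i - y $ i\<bar> \<le> sup_diameter S"
proof -
  obtain K where K: "\<And>z. z \<in> S \<Longrightarrow> norm z \<le> K"
    using assms(1) by (auto simp: bounded_iff)
  have "bdd_above ((\<lambda>(x, y). infnorm (x - y)) ` (S \<times> S))"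
  proof (rule bdd_aboveI2)
    fix z assume "z \<in> S \<times> S"
    then have "norm (fst z) \<le> K" "norm (snd z) \<le> K" using K by auto
    then show "(\<lambda>(x, y). infnorm (x - y)) z \<le> K + K"
      using infnorm_le_norm[of "fst z - snd z"] norm_triangle_ineq4[of "fst z" "snd z"]
      by (auto simp: case_prod_beta)
  qed
  then have "infnorm (x - y) \<le> sup_diameter S"
    using assms cSUP_upper[of "(x, y)" "S \<times> S" "\<lambda>(x, y). infnorm (x - y)"]
    by (auto simp: sup_diameter_def)
  then show ?thesis
    using component_le_infnorm_cart[of "x - y" i] by simp
qed

text \<open>The pieces lie in cells of a fixed level \<open>s0\<close>. Inside such a cell parameter
  distances carry an extra factor \<open>1 / R ^ s0\<close>, which absorbs all constants of the
  covering into the prescribed \<open>c\<close>.\<close>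

lemma exists_well_spread_cover:
  fixes \<Lambda> :: "(real^'d) set"
  assumes dim: "hom_box_dim_at_most \<Lambda> \<gamma>" and \<Lambda>: "bounded \<Lambda>"
    and \<alpha>: "0 < \<alpha>" and \<gamma>: "0 < \<gamma>" "\<gamma> < 1 / \<alpha>" and c: "0 < c"
  shows "\<exists>F. finite F \<and> \<Lambda> \<subseteq> \<Union>F \<and> (\<forall>D\<in>F. D \<subseteq> \<Lambda> \<and> well_spread \<alpha> c \<Lambda> D)"
proof -

  \<comment> \<open>Cells, the base of the expansion and the nesting of prefixes\<close>
  obtain r C and L :: "nat list \<Rightarrow> (real^'d) set" where r: "r \<ge> 2" and C: "C > 0"
    and cells: "\<forall>m\<ge>1.
           (\<forall>k\<in>multi_indices r m. compact (L k) \<and> L k \<subseteq> \<Lambda>) \<and>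
           (\<forall>k\<in>multi_indices r m. sup_diameter (L k) \<le> C * (1 / real r powr (1 / \<gamma>)) ^ m) \<and>
           \<Lambda> \<subseteq> (\<Union>k\<in>multi_indices r m. L k) \<and>
           (\<forall>k\<in>multi_indices r m. L k \<subseteq> L (butlast k))"
    using dim unfolding hom_box_dim_at_most_def by (elim exE conjE) (rule that)
  have sub: "L k \<subseteq> \<Lambda>"
    and diam: "sup_diameter (L k) \<le> C * (1 / real r powr (1 / \<gamma>)) ^ m"
    and nest: "L k \<subseteq> L (butlast k)"
    if "m \<ge> 1" "k \<in> multi_indices r m" for k m
    using cells that by auto
  have cover: "\<Lambda> \<subseteq> (\<Union>k\<in>multi_indices r m. L k)" if "m \<ge> 1" for m
    using cells that by auto
  define R where "R = real r powr (1 / \<gamma>)"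
  \<comment> \<open>Any base strictly between \<open>r\<close> and
    \<open>R powr (1 / \<alpha>)\<close> would do; there is one because
    \<open>\<gamma> < 1 / \<alpha>\<close>. The lower bound makes the Cantor gap
    \<open>\<kappa>\<close> positive. The upper one gives \<open>b < R\<close>: one level deeper,
    cell diameters shrink faster than \<open>\<alpha>\<close>-th powers of time distances.\<close>
  define \<beta> where "\<beta> = (real r + R powr (1 / \<alpha>)) / 2"
  define b where "b = \<beta> powr \<alpha>"
  define \<kappa> where "\<kappa> = 1 / real r - 1 / \<beta>"
  have "real r powr 1 < real r powr (1 / \<gamma> * (1 / \<alpha>))"
    using r \<alpha> \<gamma> by (intro powr_less_mono) (auto simp: field_simps)
  then have r_less: "real r < R powr (1 / \<alpha>)"
    using r by (simp add: R_def powr_powr)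
  then have \<beta>: "real r < \<beta>" "\<beta> < R powr (1 / \<alpha>)"
    by (auto simp: \<beta>_def)
  have R: "R > 1"
    using r \<gamma> by (simp add: R_def)
  have "b < (R powr (1 / \<alpha>)) powr \<alpha>"
    unfolding b_def using \<beta> r \<alpha> by (intro powr_less_mono2) auto
  then have bR: "b < R"
    using R \<alpha> by (simp add: powr_powr)
  have b0: "b > 0"
    using \<beta> r by (simp add: b_def)
  have \<kappa>: "0 < \<kappa>" "\<kappa> \<le> 1"
  proof -
    show "0 < \<kappa>"
      using \<beta> r by (simp add: \<kappa>_def frac_less2)
    have "1 / real r \<le> 1" "0 \<le> 1 / \<beta>"
      using \<beta> r by (auto simp: field_simps)
    then show "\<kappa> \<le> 1"
      unfolding \<kappa>_def by linarith
  qed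
  have \<beta>_pow: "(\<beta> ^ n) powr \<alpha> = b ^ n" for n
    using \<beta> r by (simp add: b_def powr_power mult.commute powr_realpow[symmetric] powr_powr)
  have close: "\<bar>x $ i - y $ i\<bar> \<le> C / R ^ n"
    if "n \<ge> 1" "k \<in> multi_indices r n" "x \<in> L k" "y \<in> L k" for x y k n i
  proof -
    have "bounded (L k)"
      using sub[OF that(1,2)] \<Lambda> bounded_subset by blast
    then have "\<bar>x $ i - y $ i\<bar> \<le> sup_diameter (L k)"
      using that by (intro component_diff_le_sup_diameter)
    also have "\<dots> \<le> C * (1 / R) ^ n"
      using diam[OF that(1,2)] by (simp add: R_def)
    finally show ?thesis by (simp add: power_divide)
  qed
  have prefix: "L k \<subseteq> L (take n k)" if "set k \<subseteq> {1..r}" for k n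
    using that
  proof (induction k rule: rev_induct)
    case (snoc a k)
    have "L (k @ [a]) \<subseteq> L k"
      using nest[of "length (k @ [a])" "k @ [a]"] snoc.prems by (simp add: multi_indices_def)
    with snoc show ?case
      by (cases "n \<le> length k") auto
  qed simp

  \<comment> \<open>The level of the pieces and the covering of \<Lambda>\<close>
  have "(\<lambda>n. C * 3 powr \<alpha> * (1 / R) ^ n) \<longlonglongrightarrow> C * 3 powr \<alpha> * 0"
    using R by (intro tendsto_intros LIMSEQ_power_zero) auto
  then have "\<forall>\<^sub>F n in sequentially. C * 3 powr \<alpha> * (1 / R) ^ n < c * (\<kappa> / 2) powr \<alpha>"
    using c \<kappa> by (intro order_tendstoD(2)) auto
  then have "\<forall>\<^sub>F n in sequentially. C * 3 powr \<alpha> * (1 / R) ^ n < c * (\<kappa> / 2) powr \<alpha> \<and> 1 \<le> n"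
    using eventually_ge_at_top[of 1] by eventually_elim auto
  \<comment> \<open>The factor 3 anticipates \<open>2 * T + G \<le> 3 * T\<close>, and
    \<open>\<kappa> / 2\<close> is the gap constant left after rounding times to integers. The cells
    are controlled from level 1 on, hence \<open>s0 \<ge> 1\<close>.\<close>
  then obtain s0 where s0: "s0 \<ge> 1" "C * 3 powr \<alpha> / R ^ s0 \<le> c * (\<kappa> / 2) powr \<alpha>"
    by (force simp: eventually_sequentially power_divide)

  have fin: "finite (multi_indices r s0)"
    using finite_lists_length_eq[of "{1..r}" s0] by (simp add: multi_indices_def conj_commute)
  \<comment> \<open>The cells below \<open>L k0\<close> need not cover \<open>L k0\<close>: only the union of all cells of a level covers \<open>\<Lambda>\<close>.
    The set \<open>D k0\<close> is the part of \<open>L k0\<close> reached at every depth; nesting and finiteness of the level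
    make these sets cover \<open>\<Lambda>\<close>.\<close>
  define D where "D k0 = {l. \<forall>m. \<exists>w\<in>multi_indices r m. l \<in> L (k0 @ w)}" for k0
  have "\<Lambda> \<subseteq> (\<Union>k0\<in>multi_indices r s0. D k0)"
  proof (rule subsetI, rule ccontr)
    fix l assume l: "l \<in> \<Lambda>" and "l \<notin> (\<Union>k0\<in>multi_indices r s0. D k0)"
    then have "\<forall>k0\<in>multi_indices r s0. \<exists>m. \<forall>w\<in>multi_indices r m. l \<notin> L (k0 @ w)"
      by (auto simp: D_def)
    then obtain m where m: "\<And>k0 w. k0 \<in> multi_indices r s0 \<Longrightarrow> w \<in> multi_indices r (m k0) \<Longrightarrow> l \<notin> L (k0 @ w)"
      by metis
    \<comment> \<open>A cell of level \<open>s0 + M\<close> around \<open>l\<close> is long enough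
      to be cut back to length \<open>s0 + m k0\<close>, whatever its prefix \<open>k0\<close>; by
      nesting the shorter cell still contains \<open>l\<close>, against the choice of
      \<open>m\<close>.\<close>
    define M where "M = Max (m ` multi_indices r s0)"
    have "s0 + M \<ge> 1" using s0(1) by simp
    then obtain k where k: "k \<in> multi_indices r (s0 + M)" "l \<in> L k"
      using l cover by blast
    define k0 where "k0 = take s0 k"
    have k0: "k0 \<in> multi_indices r s0"
      using k by (auto simp: k0_def multi_indices_def dest: in_set_takeD)
    have "m k0 \<le> M"
      using k0 fin by (simp add: M_def)
    then have "take (m k0) (drop s0 k) \<in> multi_indices r (m k0)"
      using k by (auto simp: multi_indices_def dest!: in_set_takeD in_set_dropD)
    moreover have "k0 @ take (m k0) (drop s0 k) = take (s0 + m k0) k"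
      by (simp add: k0_def take_add)
    moreover have "l \<in> L (take (s0 + m k0) k)"
      using prefix[of k "s0 + m k0"] k by (auto simp: multi_indices_def)
    ultimately show False
      using m[OF k0] by metis
  qed
  moreover have "D k0 \<subseteq> \<Lambda>" if "k0 \<in> multi_indices r s0" for k0
  proof
    fix l assume "l \<in> D k0"
    then obtain w where "w \<in> multi_indices r 0" "l \<in> L (k0 @ w)"
      unfolding D_def by blast
    then show "l \<in> \<Lambda>"
      using sub[OF s0(1) that] by (auto simp: multi_indices_def)
  qed

  \<comment> \<open>Spreading one piece over an interval of times\<close>
  moreover have "well_spread \<alpha> c \<Lambda> (D k0)" if k0: "k0 \<in> multi_indices r s0" for k0
    unfolding well_spread_def
  proof (intro allI impI)
    fix G B :: nat and \<delta> :: real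
    assume \<delta>: "\<delta> > 0"
    \<comment> \<open>For \<open>T \<ge> H * \<beta> ^ m\<close> the gap
      \<open>T * \<kappa> / \<beta> ^ s\<close> is at least \<open>2 * (1 + G)\<close> for all
      \<open>s < m\<close>. Giving up 1 for rounding then leaves at least half of the gap, and at
      least \<open>G + 1\<close>.\<close>
    define H where "H = 2 * (1 + real G) / \<kappa>"
    have H: "H \<ge> 1"
      using \<kappa> by (simp add: H_def field_simps)
    \<comment> \<open>Sampling at depth \<open>m\<close> costs at most \<open>C / R ^ m\<close>,
      while \<open>2 * T + G \<le> 3 * T \<le> 6 * H * \<beta> ^ m\<close> turns the time factor
      into \<open>(6 * H) powr \<alpha> * b ^ m\<close>; the product vanishes because
      \<open>b < R\<close>.\<close>
    have "(\<lambda>m. C * (6 * H) powr \<alpha> * (b / R) ^ m) \<longlonglongrightarrow> C * (6 * H) powr \<alpha> * 0"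
      using bR b0 by (intro tendsto_intros LIMSEQ_power_zero) auto
    then have "\<forall>\<^sub>F m in sequentially. C * (6 * H) powr \<alpha> * (b / R) ^ m < \<delta>"
      using \<delta> by (intro order_tendstoD(2)) auto
    moreover obtain m0 where m0: "real B + real G < \<beta> ^ m0"
      using real_arch_pow[of \<beta>] \<beta> r by auto
    have "real B + real G \<le> \<beta> ^ m" if "m0 \<le> m" for m
    proof -
      have "\<beta> ^ m0 \<le> \<beta> ^ m"
        using \<beta> r that by (intro power_increasing) auto
      then show ?thesis using m0 by linarith
    qed
    then have "\<forall>\<^sub>F m in sequentially. real B + real G \<le> \<beta> ^ m"
      by (auto simp: eventually_sequentially)
    ultimately have "\<forall>\<^sub>F m in sequentially. C * (6 * H) powr \<alpha> * (b / R) ^ m < \<delta> \<and>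
        real B + real G \<le> \<beta> ^ m"
      by eventually_elim auto
    then obtain m where m\<delta>: "C * (6 * H) powr \<alpha> * (b / R) ^ m < \<delta>" and mB: "real B + real G \<le> \<beta> ^ m"
      by (auto simp: eventually_sequentially)
    define T where "T = nat \<lceil>H * \<beta> ^ m\<rceil>"
    have \<beta>m: "1 \<le> \<beta> ^ m"
      using \<beta> r by (intro one_le_power) auto
    have H\<beta>: "\<beta> ^ m \<le> H * \<beta> ^ m"
      using H \<beta>m by (simp add: mult_left_le_imp_le)
    have T: "H * \<beta> ^ m \<le> real T" "real T \<le> 2 * (H * \<beta> ^ m)"
      unfolding T_def using H\<beta> \<beta>m by linarith+
    have TBG: "B + G \<le> T"
      using mB H\<beta> T(1) by linarith
    \<comment> \<open>Empty cells are discarded so that each remaining word has a point to sample.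
      Injectivity of \<open>pos\<close> on \<open>V\<close>, derived below from \<open>gap\<close>,
      lets \<open>inv_into\<close> recover the word from its time.\<close>
    define V where "V = {w \<in> multi_indices r m. L (k0 @ w) \<noteq> {}}"
    define pos where "pos w = T + nat \<lfloor>real T * offset r \<beta> w\<rfloor>" for w
    define \<mu> where "\<mu> t = (SOME x. x \<in> L (k0 @ inv_into V pos t))" for t
    have word: "k0 @ w \<in> multi_indices r (s0 + m)" if "w \<in> V" for w
      using that k0 by (auto simp: V_def multi_indices_def)
    have gap: "\<exists>s<m. take s v = take s w \<and> real T * (\<kappa> / 2) / \<beta> ^ s \<le> \<bar>real (pos v) - real (pos w)\<bar> \<and>
        real G + 1 \<le> \<bar>real (pos v) - real (pos w)\<bar>" if vw': "v \<in> V" "w \<in> V" "v \<noteq> w" for v w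
    proof -
      have vw: "length v = m" "length w = m" "set v \<subseteq> {1..r}" "set w \<subseteq> {1..r}"
        using vw' by (auto simp: V_def multi_indices_def)
      obtain s where s: "s < m" "take s v = take s w"
        and sep: "\<kappa> / \<beta> ^ s \<le> \<bar>offset r \<beta> v - offset r \<beta> w\<bar>"
        using offset_separated[of r \<beta> v w] vw vw'(3) \<beta> r by (auto simp: \<kappa>_def)
      have "2 * (1 + real G) = H * \<beta> ^ m * (\<kappa> / \<beta> ^ m)"
        using \<kappa> \<beta> r by (simp add: H_def)
      also have "\<dots> \<le> real T * (\<kappa> / \<beta> ^ s)"
        using T(1) \<kappa> \<beta> r s(1) H \<beta>m
        by (intro mult_mono divide_left_mono power_increasing) auto
      finally have 1: "2 * (1 + real G) \<le> real T * (\<kappa> / \<beta> ^ s)" .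
      have "real T * (\<kappa> / \<beta> ^ s) \<le> \<bar>real T * offset r \<beta> v - real T * offset r \<beta> w\<bar>"
        using mult_left_mono[OF sep, of "real T"] by (simp add: abs_mult right_diff_distrib[symmetric])
      moreover have "0 \<le> real T * offset r \<beta> v" "0 \<le> real T * offset r \<beta> w"
        using offset_bounds(1)[of r \<beta>] vw \<beta> r by auto
      then have "real (pos v) = real T + of_int \<lfloor>real T * offset r \<beta> v\<rfloor>"
        "real (pos w) = real T + of_int \<lfloor>real T * offset r \<beta> w\<rfloor>"
        by (auto simp: pos_def)
      ultimately have "real T * (\<kappa> / \<beta> ^ s) - 1 \<le> \<bar>real (pos v) - real (pos w)\<bar>"
        by linarith
      with 1 s show ?thesis
        by (intro exI[of _ s]) (auto simp: field_simps)
    qed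
    have inj: "inj_on pos V"
    proof (rule inj_onI, rule ccontr)
      fix v w assume "v \<in> V" "w \<in> V" "pos v = pos w" "v \<noteq> w"
      then show False using gap[of v w] by auto
    qed
    have \<mu>: "\<mu> (pos w) \<in> L (k0 @ w)" if "w \<in> V" for w
      using that inv_into_f_f[OF inj that] by (auto simp: \<mu>_def V_def some_in_eq)
    have "pos ` V \<subseteq> {T..2 * T}"
    proof clarify
      fix w assume "w \<in> V"
      then have "offset r \<beta> w \<le> 1"
        using offset_bounds(2)[of r \<beta> w] \<beta> r by (auto simp: V_def multi_indices_def)
      then have "real T * offset r \<beta> w \<le> real T"
        by (simp add: mult_left_le)
      then have "nat \<lfloor>real T * offset r \<beta> w\<rfloor> \<le> T"
        by linarith
      then show "pos w \<in> {T..2 * T}"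
        by (simp add: pos_def)
    qed
    moreover have "\<mu> ` pos ` V \<subseteq> \<Lambda>"
      using \<mu> sub[OF _ word] s0(1) by fastforce
    moreover have "\<forall>k\<in>pos ` V. \<forall>t\<in>pos ` V. k < t \<longrightarrow> k + G \<le> t"
      using gap by fastforce
    moreover have "\<exists>k\<in>pos ` V. \<forall>i.
           \<bar>l $ i - \<mu> k $ i\<bar> * real (2 * T + G) powr \<alpha> \<le> \<delta> \<and>
           (\<forall>t\<in>pos ` V. k < t \<longrightarrow> \<bar>l $ i - \<mu> t $ i\<bar> * real (2 * T + G) powr \<alpha> \<le> c * real (t - k) powr \<alpha>)"
      if l: "l \<in> D k0" for l
    proof -
      have "\<exists>w\<in>V. l \<in> L (k0 @ w)"
        using l unfolding D_def V_def by fastforce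
      then obtain w where w: "w \<in> V" "l \<in> L (k0 @ w)" by blast
      have 3: "real (2 * T + G) powr \<alpha> \<le> (3 * real T) powr \<alpha>"
        using TBG \<alpha> by (intro powr_mono2) auto
      show ?thesis
      proof (intro bexI[of _ "pos w"] allI conjI ballI impI)
        fix i
        have "real (2 * T + G) powr \<alpha> \<le> (6 * H * \<beta> ^ m) powr \<alpha>"
          using T(2) TBG \<alpha> by (intro powr_mono2) auto
        also have "\<dots> = (6 * H) powr \<alpha> * b ^ m"
          using H \<beta>m \<beta>_pow by (simp add: powr_mult)
        finally have "\<bar>l $ i - \<mu> (pos w) $ i\<bar> * real (2 * T + G) powr \<alpha> \<le>
            C / R ^ (s0 + m) * ((6 * H) powr \<alpha> * b ^ m)"
          using s0(1) C R close[OF _ word[OF w(1)] w(2) \<mu>[OF w(1)]]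
          by (intro mult_mono) auto
        also have "\<dots> = (C * (6 * H) powr \<alpha> * (b / R) ^ m) / R ^ s0"
          by (simp add: power_add power_divide mult_ac)
        also have "\<dots> \<le> (C * (6 * H) powr \<alpha> * (b / R) ^ m) / 1"
          using R C b0 by (intro divide_left_mono one_le_power) auto
        finally show "\<bar>l $ i - \<mu> (pos w) $ i\<bar> * real (2 * T + G) powr \<alpha> \<le> \<delta>"
          using m\<delta> by simp
      next
        fix i t
        assume "t \<in> pos ` V" and less: "pos w < t"
        then obtain v where v: "v \<in> V" "t = pos v" by auto
        obtain s where s: "s < m" "take s v = take s w"
          and far: "real T * (\<kappa> / 2) / \<beta> ^ s \<le> \<bar>real (pos v) - real (pos w)\<bar>"
          using gap[of v w] v w less by auto
        \<comment> \<open>The shared prefix: by nesting its cell contains both \<open>l\<close> and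
          \<open>\<mu> t\<close>, so they differ by at most \<open>C / R ^ (s0 + s)\<close>, while
          the times are at least \<open>T * (\<kappa> / 2) / \<beta> ^ s\<close> apart. The
          comparison \<open>b \<le> R\<close> and the choice of \<open>s0\<close> relate the
          two.\<close>
        define k where "k = k0 @ take s w"
        have k: "k \<in> multi_indices r (s0 + s)" "k = take (s0 + s) (k0 @ w)" "k = take (s0 + s) (k0 @ v)"
          using k0 w(1) s by (auto simp: k_def V_def multi_indices_def dest: in_set_takeD)
        have "l \<in> L k" "\<mu> t \<in> L k"
          using w(2) \<mu>[OF v(1)] v(2) prefix[of "k0 @ w" "s0 + s"] prefix[of "k0 @ v" "s0 + s"]
            k(2,3) word[OF w(1)] word[OF v(1)] by (auto simp: multi_indices_def)
        then have "\<bar>l $ i - \<mu> t $ i\<bar> \<le> C / R ^ (s0 + s)"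
          using close[OF _ k(1)] s0(1) by auto
        then have "\<bar>l $ i - \<mu> t $ i\<bar> * real (2 * T + G) powr \<alpha> \<le> C / R ^ (s0 + s) * (3 * real T) powr \<alpha>"
          using 3 C R by (intro mult_mono) auto
        also have "\<dots> = (C * 3 powr \<alpha> / R ^ s0) * (real T powr \<alpha> / R ^ s)"
          by (simp add: powr_mult power_add)
        also have "\<dots> \<le> (c * (\<kappa> / 2) powr \<alpha>) * (real T powr \<alpha> / b ^ s)"
          using s0(2) bR b0 R c C by (intro mult_mono divide_left_mono power_mono) auto
        also have "\<dots> = c * (real T * (\<kappa> / 2) / \<beta> ^ s) powr \<alpha>"
          using \<kappa> \<beta> r by (simp add: powr_divide powr_mult \<beta>_pow)
        also have "\<dots> \<le> c * real (t - pos w) powr \<alpha>"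
          using far less v(2) c \<alpha> \<kappa> \<beta> r
          by (intro mult_left_mono powr_mono2) (auto simp: of_nat_diff)
        finally show "\<bar>l $ i - \<mu> t $ i\<bar> * real (2 * T + G) powr \<alpha> \<le> c * real (t - pos w) powr \<alpha>" .
      qed (use w in auto)
    qed
    ultimately show "\<exists>T A \<mu>. B \<le> T \<and> A \<subseteq> {T..2 * T} \<and> \<mu> ` A \<subseteq> \<Lambda> \<and>
        (\<forall>k\<in>A. \<forall>t\<in>A. k < t \<longrightarrow> k + G \<le> t) \<and>
        (\<forall>l\<in>D k0. \<exists>k\<in>A. \<forall>i.
           \<bar>l $ i - \<mu> k $ i\<bar> * real (2 * T + G) powr \<alpha> \<le> \<delta> \<and>
           (\<forall>t\<in>A. k < t \<longrightarrow> \<bar>l $ i - \<mu> t $ i\<bar> * real (2 * T + G) powr \<alpha> \<le> c * real (t - k) powr \<alpha>))"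
      using TBG by (intro exI[of _ T] exI[of _ "pos ` V"] exI[of _ \<mu>] conjI) auto
  qed
  ultimately show ?thesis
    using fin by (intro exI[of _ "D ` multi_indices r s0"]) auto
qed

section \<open>Simultaneous approximation\<close>

text \<open>The exponential times \<open>x i (j + k)\<close> is coordinate \<open>j\<close> of the
  \<open>k\<close>-th iterate of the shift with parameter \<open>l $ i\<close>. At a suitable time
  \<open>k\<close> of stage \<open>q\<close>, earlier events have been shifted out, the event at
  \<open>k\<close> reproduces \<open>V q\<close> up to a small factor, and later events form a
  summable tail. The same \<open>k\<close> serves all \<open>i\<close>.\<close>

lemma exists_common_approximant:
  fixes V :: "nat \<Rightarrow> 'd::finite \<Rightarrow> nat \<Rightarrow> 'a::real_normed_vector"
  assumes \<alpha>: "0 < \<alpha>" "\<alpha> \<le> 1" and a: "0 < a"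
    and bounds: "\<forall>l\<in>\<Lambda>. \<forall>i. a \<le> l $ i \<and> l $ i \<le> b"
    and D: "\<And>q. D q \<subseteq> \<Lambda>" "\<And>q. well_spread \<alpha> (a / 2) \<Lambda> (D q)"
    and V: "\<And>q. \<exists>N. \<forall>i. \<forall>j\<ge>N. V q i j = 0"
  shows "\<exists>x. (\<forall>i. summable (\<lambda>j. norm (x i j))) \<and>
     (\<forall>q. \<forall>l\<in>D q. \<exists>k. \<forall>i.
        summable (\<lambda>j. norm (exp (l $ i * (real (j + k) powr \<alpha> - real j powr \<alpha>)) *\<^sub>R x i (j + k) - V q i j)) \<and>
        (\<Sum>j. norm (exp (l $ i * (real (j + k) powr \<alpha> - real j powr \<alpha>)) *\<^sub>R x i (j + k) - V q i j))
          \<le> 1 / (real q + 1))"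
proof -

  \<comment> \<open>Constants attached to the targets\<close>
  have \<Lambda>: "a \<le> l $ i" "l $ i \<le> b" if "l \<in> \<Lambda>" for l i
    using bounds that by auto
  obtain N where N: "\<And>q i j. N q \<le> j \<Longrightarrow> V q i j = 0"
    using V by metis
  define M where "M q = (\<Sum>i\<in>UNIV. \<Sum>j<N q. norm (V q i j))" for q
  have M0: "0 \<le> M q" for q
    by (auto simp: M_def intro!: sum_nonneg)
  have M: "(\<Sum>j<J. norm (V q i j)) \<le> M q" for q i J
  proof -
    have "(\<Sum>j<J. norm (V q i j)) \<le> (\<Sum>j<J + N q. norm (V q i j))"
      by (intro sum_mono2) auto
    also have "\<dots> = (\<Sum>j<N q. norm (V q i j))"
      using N by (intro sum.mono_neutral_right) auto
    also have "\<dots> \<le> M q"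
      unfolding M_def by (intro member_le_sum sum_nonneg) auto
    finally show ?thesis .
  qed
  \<comment> \<open>The tail decays with rate \<open>a / 2\<close>. This is split into two factors
    \<open>g s\<close>: one is summed over \<open>s\<close>, the other beats the constant
    \<open>W q\<close> once \<open>s \<ge> G0 q\<close>.\<close>
  define g where "g s = exp (- (a / 4) * real s powr \<alpha>)" for s :: nat
  define S where "S = (\<Sum>s. g s)"
  have g: "summable g"
    unfolding g_def using a \<alpha> by (intro summable_exp_neg_powr) auto
  have g0: "0 < g s" for s
    by (simp add: g_def)
  have S: "0 < S"
    unfolding S_def using g g0 by (rule suminf_pos)
  \<comment> \<open>Normalised so that the bounds \<open>\<epsilon> q * g s\<close> add up to
    \<open>1 / (q + 1)\<close>; being decreasing in \<open>q\<close>, it also covers events of later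
    stages.\<close>
  define \<epsilon> where "\<epsilon> q = 1 / (S * (real q + 1))" for q :: nat
  have \<epsilon>: "0 < \<epsilon> q" "q \<le> q' \<Longrightarrow> \<epsilon> q' \<le> \<epsilon> q" for q q'
    using S by (auto simp: \<epsilon>_def intro!: divide_left_mono mult_left_mono mult_pos_pos)
  define W where "W q = exp (b * real (N q) powr \<alpha>) * M q" for q
  have "\<exists>G. \<forall>n\<ge>G. W q * g n \<le> \<epsilon> q" for q
  proof -
    obtain G where "\<And>n. G \<le> n \<Longrightarrow> W q * exp (- (a / 4) * real n powr \<alpha>) \<le> \<epsilon> q"
      using exp_neg_powr_small[of "a / 4" \<alpha> "\<epsilon> q" "W q"] a \<alpha> \<epsilon>(1)[of q] by auto
    then show ?thesis
      by (auto simp: g_def)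
  qed
  then obtain G0 where G0: "\<And>q n. G0 q \<le> n \<Longrightarrow> W q * g n \<le> \<epsilon> q"
    by metis
  \<comment> \<open>Times of one stage are thus far enough apart for the tail estimate and for the
    block of one event to end before the next; the \<open>+ 1\<close> makes distinct stages
    disjoint.\<close>
  define G where "G q = G0 q + N q + 1" for q
  \<comment> \<open>The \<open>+ 1\<close> keeps the bound positive when
    \<open>M q = 0\<close>.\<close>
  have "\<exists>\<delta>>0. \<forall>z. \<bar>z\<bar> \<le> \<delta> \<longrightarrow> \<bar>exp z - 1\<bar> \<le> \<epsilon> q / (M q + 1)" for q
    using exp_minus_one_small[of "\<epsilon> q / (M q + 1)"] \<epsilon>(1)[of q] M0[of q]
    by (smt (verit, best) divide_pos_pos)
  then obtain \<delta> where \<delta>: "\<And>q. 0 < \<delta> q" "\<And>q z. \<bar>z\<bar> \<le> \<delta> q \<Longrightarrow> \<bar>exp z - 1\<bar> \<le> \<epsilon> q / (M q + 1)"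
    by metis
  \<comment> \<open>From time \<open>K * k\<close> on, half of the decay dominates
    \<open>b * k powr \<alpha>\<close>. The absolute value covers a negative \<open>b\<close>,
    possible for empty \<open>\<Lambda>\<close>; the \<open>+ 1\<close> gives
    \<open>K \<ge> 1\<close>.\<close>
  define K where "K = nat \<lceil>\<bar>2 * b / a\<bar> powr (1 / \<alpha>)\<rceil> + 1"
  have K1: "1 \<le> K"
    by (simp add: K_def)
  have K: "b \<le> a / 2 * real K powr \<alpha>"
  proof -
    have "\<bar>2 * b / a\<bar> powr (1 / \<alpha>) \<le> real K"
      using real_nat_ceiling_ge[of "\<bar>2 * b / a\<bar> powr (1 / \<alpha>)"] unfolding K_def by linarith
    then have "(\<bar>2 * b / a\<bar> powr (1 / \<alpha>)) powr \<alpha> \<le> real K powr \<alpha>"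
      using \<alpha> by (intro powr_mono2) auto
    then have "\<bar>2 * b / a\<bar> \<le> real K powr \<alpha>"
      using \<alpha> by (simp add: powr_powr)
    then have "2 * b / a \<le> real K powr \<alpha>"
      by linarith
    then show ?thesis
      using a by (simp add: field_simps)
  qed

  \<comment> \<open>Choice of the stages\<close>
  define P where "P q s \<longleftrightarrow> (case s of (T, A, \<mu>) \<Rightarrow> G q \<le> T \<and> A \<subseteq> {T..2 * T} \<and> \<mu> ` A \<subseteq> \<Lambda> \<and>
        (\<forall>k\<in>A. \<forall>t\<in>A. k < t \<longrightarrow> k + G q \<le> t) \<and>
        (\<forall>l\<in>D q. \<exists>k\<in>A. \<forall>i.
           \<bar>l $ i - \<mu> k $ i\<bar> * real (2 * T + G q) powr \<alpha> \<le> \<delta> q \<and>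
           (\<forall>t\<in>A. k < t \<longrightarrow> \<bar>l $ i - \<mu> t $ i\<bar> * real (2 * T + G q) powr \<alpha> \<le> a / 2 * real (t - k) powr \<alpha>)))"
    for q and s :: "nat \<times> nat set \<times> (nat \<Rightarrow> real^'d)"
  have stage: "\<exists>s. P q s \<and> B \<le> fst s" for q B
  proof -
    obtain T A \<mu> where T: "B + G q \<le> T" and TA: "A \<subseteq> {T..2 * T}" "\<mu> ` A \<subseteq> \<Lambda>"
        "\<forall>k\<in>A. \<forall>t\<in>A. k < t \<longrightarrow> k + G q \<le> t"
        "\<forall>l\<in>D q. \<exists>k\<in>A. \<forall>i.
           \<bar>l $ i - \<mu> k $ i\<bar> * real (2 * T + G q) powr \<alpha> \<le> \<delta> q \<and>
           (\<forall>t\<in>A. k < t \<longrightarrow> \<bar>l $ i - \<mu> t $ i\<bar> * real (2 * T + G q) powr \<alpha> \<le> a / 2 * real (t - k) powr \<alpha>)"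
      using D(2)[unfolded well_spread_def, rule_format, OF \<delta>(1)[of q], of "B + G q" "G q" q]
      by (elim exE conjE) (rule that)
    then have "P q (T, A, \<mu>)"
      unfolding P_def prod.case by (intro conjI) (use T in simp_all)
    with T show ?thesis
      by (intro exI[of _ "(T, A, \<mu>)"]) simp
  qed
  \<comment> \<open>Times of stage \<open>q\<close> are at most twice its \<open>T\<close>, so the
    next stage starts after \<open>K\<close> times each of them and after the last block has
    ended.\<close>
  have "\<exists>st. \<forall>q. P q (st q) \<and> 2 * K * fst (st q) + N q + G (Suc q) \<le> fst (st (Suc q))"
    by (rule dependent_nat_choice) (use stage in blast)+
  then obtain st where st: "\<And>q. P q (st q)" "\<And>q. 2 * K * fst (st q) + N q + G (Suc q) \<le> fst (st (Suc q))"
    by blast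
  define T A mu where "T q = fst (st q)" and "A q = fst (snd (st q))" and "mu q = snd (snd (st q))" for q
  have "P q (T q, A q, mu q)" for q
    using st(1)[of q] by (simp add: T_def A_def mu_def)
  note P = this[unfolded P_def prod.case]
  have GT: "G q \<le> T q" and AT: "t \<in> A q \<Longrightarrow> T q \<le> t" "t \<in> A q \<Longrightarrow> t \<le> 2 * T q"
    and mu: "t \<in> A q \<Longrightarrow> mu q t \<in> \<Lambda>"
    and gap: "k \<in> A q \<Longrightarrow> t \<in> A q \<Longrightarrow> k < t \<Longrightarrow> k + G q \<le> t" for q t k
    using P[of q] by auto
  have T_less: "2 * K * T q' + N q' + G q \<le> T q" if "q' < q" for q q'
    using that
  proof (induction q)
    case (Suc q)
    have "2 * K * T q + N q + G (Suc q) \<le> T (Suc q)"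
      using st(2)[of q] by (simp add: T_def)
    moreover have "T q \<le> 2 * K * T q"
      using K1 by simp
    moreover have "2 * K * T q' + N q' + G q \<le> T q" if "q' \<noteq> q"
      using Suc that by auto
    ultimately show ?case
      by (cases "q' = q") (fastforce, linarith)
  qed simp
  have A_less: "t + N q' + G q \<le> k" "K * t \<le> k" if "q' < q" "t \<in> A q'" "k \<in> A q" for t k q q'
  proof -
    have "K * t \<le> K * (2 * T q')" "2 * T q' \<le> 2 * K * T q'"
      using AT(2)[OF that(2)] K1 by auto
    moreover have "K * (2 * T q') = 2 * K * T q'"
      by simp
    ultimately show "t + N q' + G q \<le> k" "K * t \<le> k"
      using T_less[OF that(1)] AT(1)[OF that(3)] AT(2)[OF that(2)] by linarith+
  qed
  have unique: "q = q'" if "t \<in> A q" "t \<in> A q'" for t q q'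
    using A_less(1)[of q q' t t] A_less(1)[of q' q t t] that
    by (cases q q' rule: linorder_cases) (auto simp: G_def)

  \<comment> \<open>The vector as a superposition of events\<close>
  define u where "u t = (if \<exists>q. t \<in> A q then V (SOME q. t \<in> A q) else (\<lambda>_ _. 0))" for t
  define \<mu> where "\<mu> t = mu (SOME q. t \<in> A q) t" for t
  have event: "u t = V q" "\<mu> t = mu q t" if "t \<in> A q" for t q
  proof -
    have "(SOME q. t \<in> A q) = q"
      using that unique by (intro some_equality) auto
    then show "u t = V q" "\<mu> t = mu q t"
      using that by (auto simp: u_def \<mu>_def)
  qed
  have no_event: "u t = (\<lambda>_ _. 0)" if "\<And>q. t \<notin> A q" for t
    using that by (simp add: u_def)
  \<comment> \<open>\<open>F t\<close> is the block of the event at time \<open>t\<close>, placed at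
    coordinates \<open>t + j\<close>. After \<open>k\<close> shifts the event at
    \<open>k + s\<close> occupies coordinates \<open>s + j\<close>, where its entries are
    \<open>f k l s i j\<close>.\<close>
  define F where "F t i j = exp (- (\<mu> t $ i) * (real (t + j) powr \<alpha> - real j powr \<alpha>)) *\<^sub>R u t i j" for t i j
  define x where "x i n = (\<Sum>t\<le>n. F t i (n - t))" for i n
  define f where "f k l s i j = exp (l * (real (k + s + j) powr \<alpha> - real (s + j) powr \<alpha>)) *\<^sub>R F (k + s) i j"
    for k s j and l :: real and i

  \<comment> \<open>Bounds for events after time k\<close>
  have tail: "(\<Sum>j<J. norm (f k l s i j)) \<le> \<epsilon> q * g s"
    if t: "k + s \<in> A q" and s: "G q \<le> s"
      and E: "\<And>j. j \<le> N q \<Longrightarrow> l * (real (k + s + j) powr \<alpha> - real (s + j) powr \<alpha>)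
                - \<mu> (k + s) $ i * (real (k + s + j) powr \<alpha> - real j powr \<alpha>)
                \<le> b * real (N q) powr \<alpha> - a / 2 * real s powr \<alpha>" for J k l s i q
  proof -
    have "norm (f k l s i j) \<le> exp (b * real (N q) powr \<alpha> - a / 2 * real s powr \<alpha>) * norm (V q i j)" for j
    proof (cases "j \<le> N q")
      case True
      have "norm (f k l s i j) = exp (l * (real (k + s + j) powr \<alpha> - real (s + j) powr \<alpha>)
                - \<mu> (k + s) $ i * (real (k + s + j) powr \<alpha> - real j powr \<alpha>)) * norm (V q i j)"
        by (simp add: f_def F_def event(1)[OF t] exp_diff exp_minus divide_inverse)
      also have "\<dots> \<le> exp (b * real (N q) powr \<alpha> - a / 2 * real s powr \<alpha>) * norm (V q i j)"
        using E[OF True] by (intro mult_right_mono) auto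
      finally show ?thesis .
    qed (use N in \<open>simp add: f_def F_def event(1)[OF t]\<close>)
    then have "(\<Sum>j<J. norm (f k l s i j)) \<le>
        (\<Sum>j<J. exp (b * real (N q) powr \<alpha> - a / 2 * real s powr \<alpha>) * norm (V q i j))"
      by (intro sum_mono)
    also have "\<dots> \<le> exp (b * real (N q) powr \<alpha> - a / 2 * real s powr \<alpha>) * M q"
      unfolding sum_distrib_left[symmetric] by (intro mult_left_mono M) auto
    also have "b * real (N q) powr \<alpha> - a / 2 * real s powr \<alpha> =
        b * real (N q) powr \<alpha> + - (a / 4) * real s powr \<alpha> + - (a / 4) * real s powr \<alpha>"
      by simp
    also have "exp \<dots> * M q = W q * g s * g s"
      unfolding exp_add by (simp add: W_def g_def mult_ac)
    also have "\<dots> \<le> \<epsilon> q * g s"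
      using G0[of q s] s g0[of s] by (intro mult_right_mono) (auto simp: G_def)
    finally show ?thesis .
  qed
  have later: "(\<Sum>j<J. norm (f k l s i j)) \<le> \<epsilon> q * g s"
    if t: "k + s \<in> A q" and s: "G q \<le> s" and K': "K * k \<le> k + s" and l: "0 \<le> l" "l \<le> b" for J k l s i q
  proof (rule tail[OF t s])
    have "b * real k powr \<alpha> \<le> a / 2 * real K powr \<alpha> * real k powr \<alpha>"
      using K by (intro mult_right_mono) auto
    also have "\<dots> = a / 2 * real (K * k) powr \<alpha>"
      by (simp add: powr_mult)
    also have "\<dots> \<le> a / 2 * real (k + s) powr \<alpha>"
      using a \<alpha> of_nat_mono[OF K', where 'a = real] by (intro mult_left_mono powr_mono2) auto
    finally have "b * real k powr \<alpha> \<le> a / 2 * real (k + s) powr \<alpha>" .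
    then show "l * (real (k + s + j) powr \<alpha> - real (s + j) powr \<alpha>)
        - \<mu> (k + s) $ i * (real (k + s + j) powr \<alpha> - real j powr \<alpha>)
        \<le> b * real (N q) powr \<alpha> - a / 2 * real s powr \<alpha>" if "j \<le> N q" for j
      using that \<alpha> a l \<Lambda>[OF mu[OF t]] event(2)[OF t]
      by (intro exponent_le_later_stage) auto
  qed

  \<comment> \<open>Summability of the vector\<close>
  have x: "summable (\<lambda>n. norm (x i n))" for i
  proof -
    have "(\<Sum>j<J. norm (F s i j)) \<le> \<epsilon> 0 * g s" for s J
    proof (cases "\<exists>q. s \<in> A q")
      case True
      then obtain q where q: "s \<in> A q" by blast
      then have "\<Lambda> \<noteq> {}" using mu by blast
      then have "0 \<le> b" using \<Lambda> a by (meson all_not_in_conv less_le_trans less_imp_le)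
      \<comment> \<open>With \<open>k = 0\<close> and \<open>l = 0\<close> the exponential in
        \<open>f\<close> is 1, so \<open>later\<close> bounds the block itself.\<close>
      then have "(\<Sum>j<J. norm (F s i j)) \<le> \<epsilon> q * g s"
        using later[where k = 0 and s = s and q = q and l = 0 and J = J and i = i] q GT[of q] AT(1)[OF q] by (simp add: f_def)
      also have "\<dots> \<le> \<epsilon> 0 * g s"
        using \<epsilon>(2)[of 0 q] g0[of s] by (intro mult_right_mono) auto
      finally show ?thesis .
    next
      case False
      then show ?thesis
        using no_event[of s] \<epsilon>(1)[of 0] g0[of s] by (simp add: F_def)
    qed
    then show ?thesis
      unfolding x_def by (rule sum_convolution_le(1)[where f = "\<lambda>s. F s i", OF _ summable_mult[OF g]])
  qed

  \<comment> \<open>Approximation at stage q\<close>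
  have "\<exists>k. \<forall>i.
        summable (\<lambda>j. norm (exp (l $ i * (real (j + k) powr \<alpha> - real j powr \<alpha>)) *\<^sub>R x i (j + k) - V q i j)) \<and>
        (\<Sum>j. norm (exp (l $ i * (real (j + k) powr \<alpha> - real j powr \<alpha>)) *\<^sub>R x i (j + k) - V q i j))
          \<le> 1 / (real q + 1)" if l: "l \<in> D q" for l q
  proof -
    obtain k where k: "k \<in> A q"
      and close: "\<And>i. \<bar>l $ i - mu q k $ i\<bar> * real (2 * T q + G q) powr \<alpha> \<le> \<delta> q"
      and sep: "\<And>i t. t \<in> A q \<Longrightarrow> k < t \<Longrightarrow>
           \<bar>l $ i - mu q t $ i\<bar> * real (2 * T q + G q) powr \<alpha> \<le> a / 2 * real (t - k) powr \<alpha>"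
      using bspec[OF P[THEN conjunct2, THEN conjunct2, THEN conjunct2, THEN conjunct2] l]
      by (elim bexE) (rule that, auto)
    have lb: "a \<le> l $ i" "l $ i \<le> b" for i
      using subsetD[OF D(1) l] \<Lambda> by auto
    \<comment> \<open>Events before \<open>k\<close> have blocks ending below coordinate
      \<open>k\<close>: within the stage because \<open>G q > N q\<close>, across stages by
      \<open>A_less\<close>.\<close>
    have early: "F t i j = 0" if "t < k" "k - t \<le> j" for t i j
    proof (cases "\<exists>q'. t \<in> A q'")
      case True
      then obtain q' where q': "t \<in> A q'" by blast
      have "N q' \<le> j"
      proof (cases q' q rule: linorder_cases)
        case less
        then show ?thesis using A_less(1)[OF less q' k] that by simp
      next
        case equal
        then show ?thesis using gap[of t q k] q' k that by (simp add: G_def)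
      next
        case greater
        then show ?thesis using A_less(1)[OF greater k q'] that by simp
      qed
      then show ?thesis
        using N by (simp add: F_def event(1)[OF q'])
    qed (simp add: F_def no_event)
    \<comment> \<open>Charging the target to the event at \<open>k\<close> itself makes the whole
      error one antidiagonal sum.\<close>
    define h where "h i s j = f k (l $ i) s i j - (if s = 0 then V q i j else 0)" for i s j
    have h: "(\<Sum>j<J. norm (h i s j)) \<le> \<epsilon> q * g s" for i s J
    proof -
      \<comment> \<open>Main term, later event of the same stage, event of another stage, no event.
        In the third case the stage is a later one, since all times of earlier stages precede
        \<open>k\<close>.\<close>
      consider "s = 0" | "s > 0" "k + s \<in> A q" | q' where "s > 0" "q' \<noteq> q" "k + s \<in> A q'"
        | "s > 0" "\<And>q'. k + s \<notin> A q'"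
        by (metis gr0I)
      then show ?thesis
      proof cases
        case 1
        have "norm (h i s j) \<le> \<epsilon> q / (M q + 1) * norm (V q i j)" for j
        proof (cases "j < N q")
          case True
          define z where "z = (l $ i - mu q k $ i) * (real (k + j) powr \<alpha> - real j powr \<alpha>)"
          have "exp z = exp (l $ i * (real (k + j) powr \<alpha> - real j powr \<alpha>)) *
              exp (- (mu q k $ i) * (real (k + j) powr \<alpha> - real j powr \<alpha>))"
            unfolding z_def exp_add[symmetric] by (simp add: left_diff_distrib)
          then have "h i s j = (exp z - 1) *\<^sub>R V q i j"
            by (simp add: h_def f_def F_def 1 event[OF k] scaleR_diff_left)
          moreover have "\<bar>z\<bar> \<le> \<delta> q"
          proof -
            have "0 \<le> real (k + j) powr \<alpha> - real j powr \<alpha>"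
              using \<alpha> by (simp add: powr_mono2)
            moreover have "real (k + j) powr \<alpha> \<le> real (2 * T q + G q) powr \<alpha>"
              using AT(2)[OF k] True \<alpha> by (intro powr_mono2) (auto simp: G_def)
            moreover have "0 \<le> real j powr \<alpha>" by simp
            ultimately have "\<bar>real (k + j) powr \<alpha> - real j powr \<alpha>\<bar> \<le> real (2 * T q + G q) powr \<alpha>"
              by linarith
            then have "\<bar>z\<bar> \<le> \<bar>l $ i - mu q k $ i\<bar> * real (2 * T q + G q) powr \<alpha>"
              unfolding z_def abs_mult by (intro mult_left_mono) auto
            with close[of i] show ?thesis by linarith
          qed
          ultimately show ?thesis
            using mult_right_mono[OF \<delta>(2)[of z q], of "norm (V q i j)"] by simp
        qed (simp add: h_def f_def F_def 1 event[OF k] N)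
        then have "(\<Sum>j<J. norm (h i s j)) \<le> (\<Sum>j<J. \<epsilon> q / (M q + 1) * norm (V q i j))"
          by (intro sum_mono)
        also have "\<dots> \<le> \<epsilon> q / (M q + 1) * M q"
          unfolding sum_distrib_left[symmetric] using \<epsilon>(1)[of q] M0[of q] by (intro mult_left_mono M) auto
        also have "\<dots> \<le> \<epsilon> q"
          using \<epsilon>(1)[of q] M0[of q] by (simp add: field_simps)
        finally show ?thesis
          by (simp add: 1 g_def)
      next
        case 2
        have "(\<Sum>j<J. norm (f k (l $ i) s i j)) \<le> \<epsilon> q * g s"
        proof (rule tail[OF 2(2)])
          show s: "G q \<le> s"
            using gap[OF k 2(2)] 2(1) by simp
          fix j assume j: "j \<le> N q"
          have "real (k + s + j) powr \<alpha> \<le> real (2 * T q + G q) powr \<alpha>"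
            using AT(2)[OF 2(2)] j \<alpha> by (intro powr_mono2) (auto simp: G_def)
          then have "\<bar>l $ i - mu q (k + s) $ i\<bar> * real (k + s + j) powr \<alpha>
              \<le> \<bar>l $ i - mu q (k + s) $ i\<bar> * real (2 * T q + G q) powr \<alpha>"
            by (intro mult_left_mono) auto
          also have "\<dots> \<le> a / 2 * real s powr \<alpha>"
            using sep[OF 2(2), of i] 2(1) by simp
          finally show "l $ i * (real (k + s + j) powr \<alpha> - real (s + j) powr \<alpha>)
              - \<mu> (k + s) $ i * (real (k + s + j) powr \<alpha> - real j powr \<alpha>)
              \<le> b * real (N q) powr \<alpha> - a / 2 * real s powr \<alpha>"
            using j \<alpha> a lb[of i] \<Lambda>[OF mu[OF 2(2)], of i] event(2)[OF 2(2)]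
            by (intro exponent_le_same_stage) auto
        qed
        then show ?thesis
          using 2(1) by (simp add: h_def)
      next
        case 3
        then have "q < q'"
          using A_less(1)[of q' q "k + s" k] k by (cases q q' rule: linorder_cases) auto
        then have "(\<Sum>j<J. norm (f k (l $ i) s i j)) \<le> \<epsilon> q' * g s"
          using A_less[of q q' k "k + s"] k 3(3) lb[of i] a by (intro later) auto
        also have "\<dots> \<le> \<epsilon> q * g s"
          using \<epsilon>(2)[of q q'] \<open>q < q'\<close> g0[of s] by (intro mult_right_mono) auto
        finally show ?thesis
          using 3(1) by (simp add: h_def)
      next
        case 4
        then show ?thesis
          using no_event[of "k + s"] \<epsilon>(1)[of q] g0[of s] by (simp add: h_def f_def F_def)
      qed
    qed
    have conv: "exp (l $ i * (real (j + k) powr \<alpha> - real j powr \<alpha>)) *\<^sub>R x i (j + k) - V q i j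
        = (\<Sum>s\<le>j. h i s (j - s))" for i j
    proof -
      have "x i (j + k) = (\<Sum>t\<in>{0 + k..j + k}. F t i (j + k - t))"
        unfolding x_def using early by (intro sum.mono_neutral_right) auto
      also have "\<dots> = (\<Sum>s\<in>{0..j}. F (s + k) i (j + k - (s + k)))"
        by (rule sum.shift_bounds_cl_nat_ivl)
      finally have "exp (l $ i * (real (j + k) powr \<alpha> - real j powr \<alpha>)) *\<^sub>R x i (j + k)
          = (\<Sum>s\<le>j. exp (l $ i * (real (j + k) powr \<alpha> - real j powr \<alpha>)) *\<^sub>R F (s + k) i (j - s))"
        by (simp add: scaleR_sum_right atLeast0AtMost)
      also have "\<dots> = (\<Sum>s\<le>j. f k (l $ i) s i (j - s))"
        by (intro sum.cong) (auto simp: f_def add_ac)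
      finally show ?thesis
        by (simp add: h_def sum_subtractf)
    qed
    have "(\<Sum>s. \<epsilon> q * g s) = 1 / (real q + 1)"
      using S unfolding suminf_mult[OF g] S_def[symmetric] by (simp add: \<epsilon>_def)
    then show ?thesis
      using sum_convolution_le[where f = "h _", OF h summable_mult[OF g]]
      by (intro exI[of _ k] allI) (simp only: conv)
  qed
  with x show ?thesis
    by blast
qed

section \<open>Balls of \<open>\<ell>\<^sub>1\<close> in the sequence spaces\<close>

text \<open>Each \<open>norm (z n)\<close> is at most the total \<open>s\<close>, so its
  \<open>p\<close>-th power is at most \<open>s powr (p - 1) * norm (z n)\<close>; summing gives
  \<open>s powr p\<close>.\<close>

lemma l1_subset_lp:
  fixes z :: "nat \<Rightarrow> 'a::real_normed_vector"
  assumes p: "1 \<le> p" and z: "summable (\<lambda>n. norm (z n))"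
  shows "z \<in> lp_space p" and "lp_norm p z \<le> (\<Sum>n. norm (z n))"
proof -
  define s where "s = (\<Sum>n. norm (z n))"
  have s0: "0 \<le> s"
    unfolding s_def using z by (intro suminf_nonneg) auto
  have le: "norm (z n) powr p \<le> s powr (p - 1) * norm (z n)" for n
  proof (cases "z n = 0")
    case False
    have "norm (z n) \<le> s"
      unfolding s_def using sum_le_suminf[OF z, of "{n}"] by simp
    then have "norm (z n) powr (p - 1) * norm (z n) \<le> s powr (p - 1) * norm (z n)"
      using p by (intro mult_right_mono powr_mono2) auto
    moreover have "norm (z n) powr (p - 1) * norm (z n) = norm (z n) powr p"
      using False by (simp add: powr_diff)
    ultimately show ?thesis by simp
  qed simp
  have sm: "summable (\<lambda>n. norm (z n) powr p)"
    by (rule summable_comparison_test[OF _ summable_mult[OF z, of "s powr (p - 1)"]]) (use le in auto)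
  then show "z \<in> lp_space p"
    by (simp add: lp_space_def)
  have "(\<Sum>n. norm (z n) powr p) \<le> (\<Sum>n. s powr (p - 1) * norm (z n))"
    by (rule suminf_le[OF le sm summable_mult[OF z]])
  also have "\<dots> = s powr (p - 1) * s"
    by (simp add: suminf_mult[OF z] s_def)
  also have "\<dots> = s powr p"
    using s0 by (cases "s = 0") (simp_all add: powr_diff)
  finally have "lp_norm p z \<le> (s powr p) powr (1 / p)"
    unfolding lp_norm_def using p sm by (intro powr_mono2) (auto intro: suminf_nonneg)
  then show "lp_norm p z \<le> (\<Sum>n. norm (z n))"
    using p s0 by (simp add: powr_powr s_def[symmetric])
qed

lemma l1_subset_c0:
  fixes z :: "nat \<Rightarrow> 'a::real_normed_vector"
  assumes z: "summable (\<lambda>n. norm (z n))"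
  shows "z \<in> c0_space" and "c0_norm z \<le> (\<Sum>n. norm (z n))"
proof -
  show "z \<in> c0_space"
    using summable_LIMSEQ_zero[OF z] by (simp add: c0_space_def tendsto_norm_zero_iff)
  have "norm (z n) \<le> (\<Sum>n. norm (z n))" for n
    using sum_le_suminf[OF z, of "{n}"] by simp
  then show "c0_norm z \<le> (\<Sum>n. norm (z n))"
    unfolding c0_norm_def by (intro cSUP_least) auto
qed

text \<open>The \<open>p\<close>-th power of the norm is the remainder of a convergent
  series.\<close>

lemma lp_norm_truncation:
  fixes y :: "nat \<Rightarrow> 'a::real_normed_vector"
  assumes p: "1 \<le> p" and y: "y \<in> lp_space p"
  shows "(\<lambda>n. lp_norm p (\<lambda>j. y j - (if j < n then y j else 0))) \<longlonglongrightarrow> 0"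
proof -
  define h where "h j = norm (y j) powr p" for j
  have h: "summable h"
    using y by (simp add: lp_space_def h_def[abs_def])
  have tail: "norm (y j - (if j < n then y j else 0)) powr p = h j - (if j \<in> {..<n} then h j else 0)" for n j
    by (simp add: h_def)
  have "(\<lambda>j. h j - (if j \<in> {..<n} then h j else 0)) sums (suminf h - sum h {..<n})" for n
    by (intro sums_diff summable_sums h sums_If_finite_set) simp
  then have eq: "(\<Sum>j. norm (y j - (if j < n then y j else 0)) powr p) = suminf h - sum h {..<n}" for n
    unfolding tail by (rule sums_unique[symmetric])
  have "(\<lambda>n. suminf h - sum h {..<n}) \<longlonglongrightarrow> suminf h - suminf h"
    by (intro tendsto_diff tendsto_const summable_LIMSEQ h)
  then have "(\<lambda>n. (suminf h - sum h {..<n}) powr (1 / p)) \<longlonglongrightarrow> 0"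
    using p sum_le_suminf[OF h]
    by (intro tendsto_zero_powrI[where b = "1 / p"]) (auto simp: h_def intro!: always_eventually)
  then show ?thesis
    by (simp add: lp_norm_def eq)
qed

lemma c0_norm_truncation:
  fixes y :: "nat \<Rightarrow> 'a::real_normed_vector"
  assumes y: "y \<in> c0_space"
  shows "(\<lambda>n. c0_norm (\<lambda>j. y j - (if j < n then y j else 0))) \<longlonglongrightarrow> 0"
proof (rule LIMSEQ_I)
  fix e :: real assume e: "0 < e"
  have "y \<longlonglongrightarrow> 0" using y by (simp add: c0_space_def)
  then obtain n0 where n0: "\<And>j. n0 \<le> j \<Longrightarrow> norm (y j) < e / 2"
    using e LIMSEQ_D[of y 0 "e / 2"] by auto
  have "norm (c0_norm (\<lambda>j. y j - (if j < n then y j else 0)) - 0) < e" if "n0 \<le> n" for n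
  proof -
    let ?t = "\<lambda>j. y j - (if j < n then y j else 0)"
    have le: "norm (?t j) \<le> e / 2" for j
      using n0[of j] that e by auto
    have "0 \<le> norm (?t 0)" by simp
    also have "\<dots> \<le> c0_norm ?t"
      unfolding c0_norm_def by (rule cSUP_upper[OF UNIV_I]) (rule bdd_aboveI2[OF le])
    finally have "0 \<le> c0_norm ?t" .
    moreover have "c0_norm ?t \<le> e / 2"
      unfolding c0_norm_def using le by (intro cSUP_least) auto
    ultimately show ?thesis using e by simp
  qed
  then show "\<exists>n0. \<forall>n\<ge>n0. norm (c0_norm (\<lambda>j. y j - (if j < n then y j else 0)) - 0) < e"
    by blast
qed

text \<open>This reduces density to \<open>\<ell>\<^sub>1\<close> approximation of finitely
  supported vectors, for both kinds of spaces at once. The centre is a truncation of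
  \<open>y\<close> in place of \<open>y\<close>: an \<open>\<ell>\<^sub>1\<close> ball around it
  contains summable vectors even when \<open>y\<close> is not summable.\<close>

lemma mtopology_contains_l1_ball:
  fixes M :: "(nat \<Rightarrow> 'a::real_normed_vector) set"
  assumes M: "Metric_space M (norm_dist M N)"
    and l1: "\<And>z. summable (\<lambda>n. norm (z n)) \<Longrightarrow> z \<in> M"
      "\<And>z. summable (\<lambda>n. norm (z n)) \<Longrightarrow> N z \<le> (\<Sum>n. norm (z n))"
    and diff: "\<And>x y. x \<in> M \<Longrightarrow> y \<in> M \<Longrightarrow> (\<lambda>n. x n - y n) \<in> M"
    and trunc: "\<And>y. y \<in> M \<Longrightarrow> (\<lambda>n. N (\<lambda>j. y j - (if j < n then y j else 0))) \<longlonglongrightarrow> 0"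
    and U: "openin (Metric_space.mtopology M (norm_dist M N)) U" "y \<in> U"
  shows "\<exists>v n e. 0 < e \<and> (\<forall>j\<ge>n. v j = 0) \<and>
           (\<forall>z. summable (\<lambda>j. norm (z j - v j)) \<longrightarrow> (\<Sum>j. norm (z j - v j)) < e \<longrightarrow> z \<in> U)"
proof -
  interpret Metric_space M "norm_dist M N" by (rule M)
  obtain r where r: "0 < r" "mball y r \<subseteq> U" and yM: "y \<in> M"
    using U unfolding openin_mtopology by (meson subsetD)
  have "\<forall>\<^sub>F n in sequentially. N (\<lambda>j. y j - (if j < n then y j else 0)) < r / 2"
    using r by (intro order_tendstoD(2)[OF trunc[OF yM]]) auto
  then obtain n where n: "N (\<lambda>j. y j - (if j < n then y j else 0)) < r / 2"
    by (auto simp: eventually_sequentially)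
  define v where "v j = (if j < n then y j else 0)" for j
  have v: "v \<in> M"
    by (intro l1 summable_finite[of "{..<n}"]) (auto simp: v_def)
  have "z \<in> U" if z: "summable (\<lambda>j. norm (z j - v j))" "(\<Sum>j. norm (z j - v j)) < r / 2" for z
  proof -
    have vz: "(\<lambda>j. v j - z j) \<in> M" "N (\<lambda>j. v j - z j) < r / 2"
      using l1[of "\<lambda>j. v j - z j"] z by (auto simp: norm_minus_commute)
    have zM: "z \<in> M"
      using diff[OF v vz(1)] by simp
    have "norm_dist M N y z \<le> norm_dist M N y v + norm_dist M N v z"
      using yM v zM by (rule triangle)
    also have "\<dots> < r / 2 + r / 2"
      using n vz yM v zM by (intro add_strict_mono) (auto simp: norm_dist_def v_def)
    finally show ?thesis
      using r(2) yM zM by auto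
  qed
  then show ?thesis
    using r(1) by (intro exI[of _ v] exI[of _ n] exI[of _ "r / 2"]) (auto simp: v_def)
qed

lemma open_contains_l1_ball:
  fixes X :: "(nat \<Rightarrow> 'a::real_normed_vector) topology"
  assumes X: "(\<exists>p::real. p \<ge> 1 \<and> X = lp_topology p) \<or> X = c0_topology"
    and U: "openin X U" "y \<in> U"
  shows "\<exists>v n e. 0 < e \<and> (\<forall>j\<ge>n. v j = 0) \<and>
           (\<forall>z. summable (\<lambda>j. norm (z j - v j)) \<longrightarrow> (\<Sum>j. norm (z j - v j)) < e \<longrightarrow> z \<in> U)"
  using X
proof (elim disjE exE conjE)
  fix p :: real assume p: "p \<ge> 1" "X = lp_topology p"
  show ?thesis
    by (rule mtopology_contains_l1_ball[OF Metric_space_lp[OF p(1)]])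
      (use p U in \<open>auto simp: lp_topology_def intro: l1_subset_lp lp_diff lp_norm_truncation\<close>)
next
  assume "X = c0_topology"
  then show ?thesis
    by (intro mtopology_contains_l1_ball[OF Metric_space_c0])
      (use U in \<open>auto simp: c0_topology_def intro: l1_subset_c0 c0_diff c0_norm_truncation\<close>)
qed

lemma l1_in_topspace:
  fixes X :: "(nat \<Rightarrow> 'a::real_normed_vector) topology"
  assumes "(\<exists>p::real. p \<ge> 1 \<and> X = lp_topology p) \<or> X = c0_topology"
    and "summable (\<lambda>n. norm (z n))"
  shows "z \<in> topspace X"
  using assms l1_subset_lp l1_subset_c0 by (auto simp: topspace_lp topspace_c0)

text \<open>Finitely supported vectors with entries in a countable dense set of scalars
  suffice.\<close>

lemma exists_countable_l1_dense:
  "\<exists>VV :: ('d::finite \<Rightarrow> nat \<Rightarrow> 'a::{real_normed_vector, second_countable_topology}) set.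
     countable VV \<and> (\<forall>v\<in>VV. \<exists>n. \<forall>i. \<forall>j\<ge>n. v i j = 0) \<and>
     (\<forall>v n e. 0 < e \<longrightarrow> (\<forall>i. \<forall>j\<ge>n. v i j = 0) \<longrightarrow>
        (\<exists>v'\<in>VV. \<forall>i. summable (\<lambda>j. norm (v' i j - v i j)) \<and> (\<Sum>j. norm (v' i j - v i j)) < e))"
proof -
  obtain Q :: "'a set" where Q: "countable Q" "\<And>S. open S \<Longrightarrow> S \<noteq> {} \<Longrightarrow> \<exists>d\<in>Q. d \<in> S"
    using countable_dense_exists[where 'a = 'a] by blast
  define ext where "ext n f i j = (if j < n then f (i, j) else 0)"
    for n and f :: "'d \<times> nat \<Rightarrow> 'a" and i j
  define VV where "VV = (\<Union>n. ext n ` (UNIV \<times> {..<n} \<rightarrow>\<^sub>E Q))"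
  have countable: "countable VV"
    unfolding VV_def using Q(1) by (intro countable_UN countable_image countable_PiE) auto
  have support: "\<forall>v\<in>VV. \<exists>n. \<forall>i. \<forall>j\<ge>n. v i j = 0"
  proof
    fix v assume "v \<in> VV"
    then obtain n f where "v = ext n f"
      by (auto simp: VV_def)
    then show "\<exists>n. \<forall>i. \<forall>j\<ge>n. v i j = 0"
      by (auto simp: ext_def intro: exI[of _ n])
  qed
  have dense: "\<exists>v'\<in>VV. \<forall>i. summable (\<lambda>j. norm (v' i j - v i j)) \<and> (\<Sum>j. norm (v' i j - v i j)) < e"
    if e: "0 < e" and v: "\<forall>i. \<forall>j\<ge>n. v i j = 0" for v :: "'d \<Rightarrow> nat \<Rightarrow> 'a" and n e
  proof -
    \<comment> \<open>The \<open>n\<close> errors add up to less than \<open>e\<close>; the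
      \<open>+ 1\<close> covers \<open>n = 0\<close>.\<close>
    define \<eta> where "\<eta> = e / (real n + 1)"
    have \<eta>: "0 < \<eta>" using e by (simp add: \<eta>_def)
    have "\<exists>d\<in>Q. d \<in> ball (v i j) \<eta>" for i j
      using \<eta> by (intro Q(2)) auto
    then obtain d where d: "\<And>i j. d i j \<in> Q" "\<And>i j. dist (v i j) (d i j) < \<eta>"
      by (metis mem_ball)
    define v' where "v' = ext n (restrict (\<lambda>(i, j). d i j) (UNIV \<times> {..<n}))"
    have v': "v' i j = (if j < n then d i j else 0)" for i j
      by (simp add: v'_def ext_def)
    have "v' \<in> VV"
      using d(1) unfolding VV_def v'_def by (intro UN_I[of n] imageI) (auto simp: restrict_PiE_iff split: if_splits)
    moreover have "summable (\<lambda>j. norm (v' i j - v i j)) \<and> (\<Sum>j. norm (v' i j - v i j)) < e" for i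
    proof
      have zero: "norm (v' i j - v i j) = 0" if "j \<notin> {..<n}" for j
        using that v by (auto simp: v')
      show "summable (\<lambda>j. norm (v' i j - v i j))"
        by (rule summable_finite[OF finite_lessThan zero])
      have "(\<Sum>j. norm (v' i j - v i j)) = (\<Sum>j<n. norm (v' i j - v i j))"
        by (rule suminf_finite[OF finite_lessThan zero])
      also have "\<dots> \<le> (\<Sum>j<n. \<eta>)"
        using d(2) by (intro sum_mono) (auto simp: v' dist_norm norm_minus_commute intro: less_imp_le)
      also have "\<dots> < e"
        using e by (simp add: \<eta>_def field_simps)
      finally show "(\<Sum>j. norm (v' i j - v i j)) < e" .
    qed
    ultimately show ?thesis by blast
  qed
  show ?thesis
    by (intro exI[of _ VV] conjI countable support allI impI) (rule dense)
qed

section \<open>Common hypercyclic vectors\<close>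

lemma weighted_shift_funpow:
  "(weighted_shift w ^^ n) x j = (\<Prod>k = Suc j..j + n. w k) *\<^sub>R x (j + n)"
proof (induction n arbitrary: j)
  case (Suc n)
  then show ?case
    using prod.atLeast_Suc_atMost[of "Suc j" "Suc (j + n)" w] by (simp add: weighted_shift_def)
qed simp

lemma product_op_funpow: "(product_op T ^^ n) x i = (T i ^^ n) (x i)"
  by (induction n) (simp_all add: product_op_def)

lemma prod_tail_exp:
  fixes w :: "nat \<Rightarrow> real"
  assumes "\<And>n. 1 \<le> n \<Longrightarrow> (\<Prod>k = 1..n. w k) = exp (a * real n powr \<alpha>)"
  shows "(\<Prod>k = Suc j..j + n. w k) = exp (a * (real (j + n) powr \<alpha> - real j powr \<alpha>))"
proof -
  \<comment> \<open>For \<open>m = 0\<close> both sides are 1, as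
    \<open>0 powr \<alpha> = 0\<close>. The partial product is then a quotient of two full
    ones.\<close>
  have full: "(\<Prod>k = 1..m. w k) = exp (a * real m powr \<alpha>)" for m
    using assms[of m] by (cases "m = 0") auto
  have "(\<Prod>k = 1..j + n. w k) = (\<Prod>k = 1..j. w k) * (\<Prod>k = Suc j..j + n. w k)"
    using prod.ub_add_nat[of 1 j w n] by simp
  then show ?thesis
    unfolding full by (simp add: right_diff_distrib exp_diff field_simps)
qed

lemma compact_positive_components_bounds:
  fixes \<Lambda> :: "(real^'d) set"
  assumes "compact \<Lambda>" "\<And>l i. l \<in> \<Lambda> \<Longrightarrow> 0 < l $ i"
  obtains a b where "0 < a" "\<forall>l\<in>\<Lambda>. \<forall>i. a \<le> l $ i \<and> l $ i \<le> b"
proof (cases "\<Lambda> = {}")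
  case True
  then show ?thesis
    by (intro that[of 1 1]) auto
next
  case False
  define S where "S = (\<Union>i\<in>UNIV. (\<lambda>l. l $ i) ` \<Lambda>)"
  have "compact ((\<lambda>l. l $ i) ` \<Lambda>)" for i
    by (intro compact_continuous_image continuous_on_component continuous_on_id assms(1))
  then have S: "compact S"
    unfolding S_def by (intro compact_UN) auto
  have S': "S \<noteq> {}"
    using False by (simp add: S_def)
  obtain a where "a \<in> S" "\<forall>t\<in>S. a \<le> t"
    using compact_attains_inf[OF S S'] by blast
  moreover obtain b where "\<forall>t\<in>S. t \<le> b"
    using compact_attains_sup[OF S S'] by blast
  ultimately show ?thesis
    using assms(2) by (intro that[of a b]) (auto simp: S_def)
qed

theorem corollary1p6:
  fixes X :: "(nat \<Rightarrow> 'a::{real_normed_field, euclidean_space}) topology"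
    and \<alpha> :: real
    and w :: "real \<Rightarrow> nat \<Rightarrow> real"
    and \<Lambda> :: "(real^'d) set"
  assumes X: "(\<exists>p::real. p \<ge> 1 \<and> X = lp_topology p) \<or> X = c0_topology"
    and \<alpha>: "0 < \<alpha>" "\<alpha> \<le> 1"
    and w_pos: "\<And>a n. a > 0 \<Longrightarrow> n \<ge> 1 \<Longrightarrow> w a n > 0"
    and w_prod: "\<And>a n. a > 0 \<Longrightarrow> n \<ge> 1 \<Longrightarrow> (\<Prod>k=1..n. w a k) = exp (a * real n powr \<alpha>)"
    and \<Lambda>: "compact \<Lambda>" "\<And>l i. l \<in> \<Lambda> \<Longrightarrow> l $ i > 0"
    and dim: "hom_box_dim \<Lambda> < ereal (1 / \<alpha>)"
  shows "\<exists>x. common_hypercyclic_vector (product_topology (\<lambda>_::'d. X) UNIV) \<Lambda>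
               (\<lambda>l. product_op (\<lambda>i. weighted_shift (w (l $ i)))) x"
proof -
  obtain \<gamma> where \<gamma>: "0 < \<gamma>" "\<gamma> < 1 / \<alpha>" "hom_box_dim_at_most \<Lambda> \<gamma>"
    using dim unfolding hom_box_dim_def INF_less_iff by auto
  obtain a b where ab: "0 < a" "\<forall>l\<in>\<Lambda>. \<forall>i. a \<le> l $ i \<and> l $ i \<le> b"
    using compact_positive_components_bounds[OF \<Lambda>] by blast
  have "0 < a / 2"
    using ab by simp
  then obtain F where F: "finite F" "\<Lambda> \<subseteq> \<Union>F" "\<And>D. D \<in> F \<Longrightarrow> D \<subseteq> \<Lambda>" "\<And>D. D \<in> F \<Longrightarrow> well_spread \<alpha> (a / 2) \<Lambda> D"
    using exists_well_spread_cover[OF \<gamma>(3) compact_imp_bounded[OF \<Lambda>(1)] \<alpha>(1) \<gamma>(1,2)] by metis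
  obtain VV :: "('d \<Rightarrow> nat \<Rightarrow> 'a) set" where VV: "countable VV"
      "\<And>v. v \<in> VV \<Longrightarrow> \<exists>n. \<forall>i. \<forall>j\<ge>n. v i j = 0"
      "\<And>v n e. 0 < e \<Longrightarrow> (\<forall>i. \<forall>j\<ge>n. v i j = 0) \<Longrightarrow>
        \<exists>v'\<in>VV. \<forall>i. summable (\<lambda>j. norm (v' i j - v i j)) \<and> (\<Sum>j. norm (v' i j - v i j)) < e"
    using exists_countable_l1_dense[where 'd = 'd and 'a = 'a] by (elim exE conjE) (rule that, auto)
  show ?thesis
  proof (cases "\<Lambda> = {}")
    \<comment> \<open>Here \<open>F\<close> may be empty, leaving nothing to enumerate; the zero
      vector serves vacuously.\<close>
    case True
    have "(\<lambda>_ _. 0) \<in> topspace (product_topology (\<lambda>_::'d. X) UNIV)"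
      using l1_in_topspace[OF X, of "\<lambda>_. 0"] by (simp add: PiE_UNIV_domain)
    then show ?thesis
      unfolding common_hypercyclic_vector_def True by blast
  next
    case False
    obtain v0 where "v0 \<in> VV"
      using VV(3)[of 1 0 "\<lambda>_ _. 0"] by auto
    moreover have "F \<noteq> {}"
      using False F(2) by auto
    ultimately have I: "VV \<times> F \<noteq> {}" "countable (VV \<times> F)"
      using VV(1) F(1) by (auto intro: countable_finite)
    \<comment> \<open>Discarding the second component of \<open>prod_decode q\<close> repeats each
      pair of a target and a piece infinitely often, hence at stages of arbitrarily small
      error.\<close>
    define item where "item q = from_nat_into (VV \<times> F) (fst (prod_decode q))" for q
    have item: "item q \<in> VV \<times> F" for q
      unfolding item_def using I(1) by (rule from_nat_into)
    have item_le: "\<exists>q\<ge>m. item q = (v, D)" if vD: "v \<in> VV" "D \<in> F" for v D m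
    proof -
      obtain p where "from_nat_into (VV \<times> F) p = (v, D)"
        using from_nat_into_surj[OF I(2), of "(v, D)"] vD by auto
      then show ?thesis
        by (intro exI[of _ "prod_encode (p, m)"]) (simp add: item_def le_prod_encode_2)
    qed
    have wf: "snd (item q) \<subseteq> \<Lambda>" "well_spread \<alpha> (a / 2) \<Lambda> (snd (item q))"
        "\<exists>n. \<forall>i. \<forall>j\<ge>n. fst (item q) i j = 0" for q
      using item[of q] F(3,4) VV(2) by (auto simp: mem_Times_iff)
    obtain x where x: "\<forall>i. summable (\<lambda>j. norm (x i j))"
      and approx: "\<forall>q. \<forall>l\<in>snd (item q). \<exists>k. \<forall>i.
        summable (\<lambda>j. norm (exp (l $ i * (real (j + k) powr \<alpha> - real j powr \<alpha>)) *\<^sub>R x i (j + k) - fst (item q) i j)) \<and>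
        (\<Sum>j. norm (exp (l $ i * (real (j + k) powr \<alpha> - real j powr \<alpha>)) *\<^sub>R x i (j + k) - fst (item q) i j))
          \<le> 1 / (real q + 1)"
      using exists_common_approximant[where D = "\<lambda>q. snd (item q)" and V = "\<lambda>q. fst (item q)",
          OF \<alpha> ab wf] by (elim exE conjE) (rule that)
    let ?X = "product_topology (\<lambda>_::'d. X) UNIV"
    let ?T = "\<lambda>l. product_op (\<lambda>i. weighted_shift (w (l $ i))) :: ('d \<Rightarrow> nat \<Rightarrow> 'a) \<Rightarrow> 'd \<Rightarrow> nat \<Rightarrow> 'a"
    have orbit: "(?T l ^^ k) x i j = exp (l $ i * (real (j + k) powr \<alpha> - real j powr \<alpha>)) *\<^sub>R x i (j + k)"
      if "l \<in> \<Lambda>" for l k i j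
      using prod_tail_exp[of "w (l $ i)" "l $ i" \<alpha> j k] w_prod \<Lambda>(2)[OF that]
      by (simp add: product_op_funpow weighted_shift_funpow)
    have "\<exists>y\<in>range (\<lambda>n. (?T l ^^ n) x). y \<in> U"
      if l: "l \<in> \<Lambda>" and U: "openin ?X U" "y0 \<in> U" for l U y0
    proof -
      obtain S where S: "\<And>i. openin X (S i)" "y0 \<in> Pi\<^sub>E UNIV S" "Pi\<^sub>E UNIV S \<subseteq> U"
        using U unfolding openin_product_topology_alt by (metis UNIV_I)
      have "\<forall>i. \<exists>v n e. 0 < e \<and> (\<forall>j\<ge>n. v j = 0) \<and>
           (\<forall>z. summable (\<lambda>j. norm (z j - v j)) \<longrightarrow> (\<Sum>j. norm (z j - v j)) < e \<longrightarrow> z \<in> S i)"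
        using open_contains_l1_ball[OF X S(1)] S(2) by blast
      then obtain v n e where e: "\<And>i. 0 < e i" and v: "\<And>i j. n i \<le> j \<Longrightarrow> v i j = 0"
        and ball: "\<And>i z. summable (\<lambda>j. norm (z j - v i j)) \<Longrightarrow> (\<Sum>j. norm (z j - v i j)) < e i \<Longrightarrow> z \<in> S i"
        by metis
      \<comment> \<open>One radius for all of the finitely many coordinates; half is spent on
        replacing \<open>v\<close> by \<open>v'\<close> and half on the orbit.\<close>
      define \<epsilon> where "\<epsilon> = Min (range e)"
      have \<epsilon>: "0 < \<epsilon>" "\<epsilon> \<le> e i" for i
        using e by (auto simp: \<epsilon>_def)
      have "n i \<le> Max (range n)" for i
        by simp
      then have "\<forall>i. \<forall>j\<ge>Max (range n). v i j = 0"
        using v le_trans by blast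
      then obtain v' where v': "v' \<in> VV" "\<And>i. summable (\<lambda>j. norm (v' i j - v i j))"
          "\<And>i. (\<Sum>j. norm (v' i j - v i j)) < \<epsilon> / 2"
        using VV(3)[OF half_gt_zero[OF \<epsilon>(1)], of "Max (range n)" v] by blast
      obtain D where D: "D \<in> F" "l \<in> D"
        using l F(2) by blast
      obtain q where q: "nat \<lceil>2 / \<epsilon>\<rceil> \<le> q" "item q = (v', D)"
        using item_le[OF v'(1) D(1)] by blast
      have "2 / \<epsilon> \<le> real q + 1"
        using q(1) by linarith
      then have q\<epsilon>: "1 / (real q + 1) \<le> \<epsilon> / 2"
        using \<epsilon>(1) by (simp add: field_simps)
      obtain k where k: "\<And>i. summable (\<lambda>j. norm ((?T l ^^ k) x i j - v' i j))"
          "\<And>i. (\<Sum>j. norm ((?T l ^^ k) x i j - v' i j)) \<le> 1 / (real q + 1)"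
        using approx[rule_format, of l q] D(2) q(2) unfolding orbit[OF l] by auto
      have "(?T l ^^ k) x i \<in> S i" for i
      proof (rule ball)
        have sm: "summable (\<lambda>j. norm ((?T l ^^ k) x i j - v' i j) + norm (v' i j - v i j))"
          by (intro summable_add k v')
        have le: "norm ((?T l ^^ k) x i j - v i j) \<le> norm ((?T l ^^ k) x i j - v' i j) + norm (v' i j - v i j)" for j
          by (metis dist_norm dist_triangle)
        show sm': "summable (\<lambda>j. norm ((?T l ^^ k) x i j - v i j))"
          by (rule summable_comparison_test[OF _ sm]) (use le in auto)
        have "(\<Sum>j. norm ((?T l ^^ k) x i j - v i j))
            \<le> (\<Sum>j. norm ((?T l ^^ k) x i j - v' i j) + norm (v' i j - v i j))"
          by (rule suminf_le[OF le sm' sm])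
        also have "\<dots> = (\<Sum>j. norm ((?T l ^^ k) x i j - v' i j)) + (\<Sum>j. norm (v' i j - v i j))"
          by (rule suminf_add[symmetric, OF k(1) v'(2)])
        also have "\<dots> < e i"
          using k(2)[of i] v'(3)[of i] q\<epsilon> \<epsilon>(2)[of i] by linarith
        finally show "(\<Sum>j. norm ((?T l ^^ k) x i j - v i j)) < e i" .
      qed
      then show ?thesis
        using S(3) by (intro bexI[of _ "(?T l ^^ k) x"]) auto
    qed
    then have "?X closure_of range (\<lambda>n. (?T l ^^ n) x) = topspace ?X" if "l \<in> \<Lambda>" for l
      using that unfolding closure_of_def by blast
    moreover have "x \<in> topspace ?X"
      using l1_in_topspace[OF X x[rule_format]] by (simp add: PiE_UNIV_domain)
    ultimately show ?thesis
      unfolding common_hypercyclic_vector_def by blast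
  qed
qed

end
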